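(* Consider an $f$-sequence $\{G^N\}_N$ satisfying the standing assumptions (a)–(d) of the context and in the $(\mathbf w,\mathbf v,\mathbf p)$-subcritical regime. Choose $\boldsymbol\varepsilon\in\mathrm{Poly}(\mathbf p)$ and consider the sub-systems $\{\tilde G^N(\mathbf p,\boldsymbol\varepsilon)\}_N$ constructed by the ICRD approach, under the JIQ policy. Then the steady-state probability that an arriving task joins a busy server converges to $0$ as $N\to\infty$.
   Context: Notation: $[n]=\{1,\dots,n\}$; $|\cdot|$ of a subset of $[0,1)$ is Lebesgue measure. Model. $G^N=(\mathcal W^N,\mathcal V^N,\boldsymbol\lambda^N,\mathcal U^N)$ is a load balancing system with dispatchers $\mathcal W^N=\{1,\dots,W(N)\}$ (each dispatcher handles exactly one type of task, so dispatcher = task type) and servers $\mathcal V^N=\{1,\dots,N\}$. Each server has its own infinite-buffer queue served First-Come-First-Served. Tasks arrive at dispatcher $i$ as a Poisson process of rate $\lambda_i^N$, independently of the other processes, and must be assigned instantaneously and irrevocably to a compatible server. The service time of a type-$i$ task at server $j$ is exponential with mean $1/\mu^N_{i,j}$ if $\mu^N_{i,j}>0$ (server $j$ is then compatible with type $i$); if $\mu^N_{i,j}=0$, server $j$ cannot process type-$i$ tasks. $\boldsymbol\lambda^N=(\lambda^N_i)$ and $\mathcal U^N=(\mu^N_{i,j})$. $f$-sequence. There are fixed maps $\phi_1,\phi_2:\mathbb N\to[0,1)$ (for dispatchers and servers) and a function $f:[0,1)^2\to\mathbb R_+$; the sets $\mathcal W^N,\mathcal V^N$ are nested increasing in $N$,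 and $\mu^N_{i,j}=f(\phi_1(i),\phi_2(j))$ for all $(i,j)\in\mathcal W^N\times\mathcal V^N$ and all $N$. Standing assumptions. (a) There is an integrable function $\lambda:[0,1)\to\mathbb R_+$ with $\int_0^1\lambda(x)dx=a>0$ and $\lambda^N_i=\lambda(\phi_1(i))$ for all $i\in\mathcal W^N$, $N\in\mathbb N$. (b) $f$ is Riemann integrable, and there is $\mu^o>0$ such that $|\{y\in[0,1):f(x,y)\ge\mu^o\}|>0$ for all $x\in[0,1)$. (c) For every subinterval $E\subseteq[0,1)$, $\lim_{N}\frac1{W(N)}\sum_{i\in\mathcal W^N}\mathbf 1_{(\phi_1(i)\in E)}=\lim_{N}\frac1N\sum_{j\in\mathcal V^N}\mathbf 1_{(\phi_2(j)\in E)}=|E|$. (d) $\lim_{N}W(N)/N=\xi>0$ for a constant $\xi$. $(\mathbf w,\mathbf v,\mathbf p)$-subcritical regime. $\mathbf w=(0=w_0<\dots<w_H=1)$ and $\mathbf v=(0=v_0<\dots<v_M=1)$ are partitions of $[0,1)$ and $\mathbf p=(p_{h,m})\in[0,1)^{H\times M}$ is a matrix with unit row sums such that $\sum_{h\in[H]}\frac{p_{h,m}\lambda_h}{(v_m-v_{m-1})\mu^*_{h,m}}<1$ for all $m\in[M]$, where $\lambda_h=\frac1\xi\int_{w_{h-1}}^{w_h}\lambda(x)dx$ and $\mu^*_{h,m}=\min_{(x,y)\in[w_{h-1},w_h)\times[v_{m-1},v_m)}f(x,y)$. (Quotients with numerator $0$ are read as $0$.) Put $\mathcal W^N_h=\{i\in\mathcal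 W^N:\phi_1(i)\in[w_{h-1},w_h)\}$ and $\mathcal V^N_m=\{j\in\mathcal V^N:\phi_2(j)\in[v_{m-1},v_m)\}$ (servers or dispatchers in the same class need not be statistically identical). $\mathrm{Poly}(\mathbf p)$. Let $\varepsilon^*_m=(v_m-v_{m-1})-\sum_{h\in[H]}\frac{\lambda_hp_{h,m}}{\mu^*_{h,m}}$. $\mathrm{Poly}(\mathbf p)$ is the set of $\boldsymbol\varepsilon=(\varepsilon_{h,m})\in[0,1)^{H\times M}$ such that $\varepsilon_{h,1}:\cdots:\varepsilon_{h,M}=p_{h,1}:\cdots:p_{h,M}$ for all $h\in[H]$, and $\sum_{h\in[H]}\varepsilon_{h,m}\le\varepsilon^*_m$ for all $m\in[M]$. ICRD sub-system $\tilde G^N(\mathbf p,\boldsymbol\varepsilon)$. Each $\mathcal V^N_m$ is divided into $H+1$ disjoint sets $\mathcal V^N_{h,m}$, $h\in[H]$, and $\mathcal V^N_{0,m}$, with $|\mathcal V^N_{h,m}|=\lfloor N(\frac{\lambda_hp_{h,m}}{\mu^*_{h,m}}+\varepsilon_{h,m})\rfloor$ for $h\in[H]$ and $|\mathcal V^N_{0,m}|=|\mathcal V^N_m|-\sum_{h\in[H]}|\mathcal V^N_{h,m}|$. The sub-system has the same dispatchers, servers and arrival rates as $G^N$; the service rate of type $i\in\mathcal W^N_h$ at server $j$ equals $\mu^N_{i,j}$ if $j\in\bigcup_{m}\mathcal V^N_{h,m}$ and is set to $0$ otherwise, so dispatchers in $\mathcal W^N_h$ may assign tasks only to servers in $\bigcup_m\mathcal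 V^N_{h,m}$. JIQ policy in $\tilde G^N$. A task arriving at a dispatcher in $\mathcal W^N_h$ is assigned to a uniformly random idle server in $\bigcup_{m}\mathcal V^N_{h,m}$ if there is one, and otherwise to a uniformly random server of $\bigcup_m\mathcal V^N_{h,m}$. A server is busy if it is not idle, i.e. its queue (including the task in service) is non-empty.
   Formalization: λ_h is taken as ξ∫λ instead of (1/ξ)∫λ (as printed the claim fails for ξ>1); λ is assumed Riemann integrable; no row of ε vanishes; the limit is uniform over all feasible divisions and all stationary distributions, whose existence is presupposed. *)

theory Defs
  imports "HOL-Probability.Probability"
begin

section \<open>Riemann integrability\<close>

text \<open>Riemann's definition: one mesh width \<open>d\<close> that works for all tags, i.e. the
  Henstock-Kurzweil definition restricted to constant gauges. The function is extended by \<open>0\<close> from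
  \<open>S\<close> to a closed box, so that half-open domains such as \<open>[0,1)\<close> are covered.\<close>

definition Riemann_integrable_on :: "('a::euclidean_space \<Rightarrow> real) \<Rightarrow> 'a set \<Rightarrow> bool" where
  "Riemann_integrable_on g S \<longleftrightarrow>
     (\<exists>a b. S \<subseteq> cbox a b \<and>
       (\<exists>I. \<forall>e>0. \<exists>d>0. \<forall>D.
          D tagged_division_of cbox a b \<and> (\<lambda>x. ball x d) fine D \<longrightarrow>
          \<bar>(\<Sum>(x, K)\<in>D. measure lborel K * (if x \<in> S then g x else 0)) - I\<bar> < e))"


section \<open>Load balancing systems\<close>

record lb_system =
  dispatchers :: "nat set"
  servers :: "nat set"
  arrival :: "nat \<Rightarrow> real"
  service :: "nat \<Rightarrow> nat \<Rightarrow> real"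

text \<open>A state records for every server the list of the types of the tasks in its queue, in order of
  arrival; the head of the list is the task in service. The whole list is needed for the Markov
  property because service rates depend on the task type.\<close>

type_synonym state = "nat \<Rightarrow> nat list"

text \<open>\<open>A s i j\<close> is the probability that a task of type \<open>i\<close> arriving in state \<open>s\<close> is assigned to
  server \<open>j\<close>.\<close>

type_synonym policy = "state \<Rightarrow> nat \<Rightarrow> nat \<Rightarrow> real"

definition jump_rate :: "lb_system \<Rightarrow> policy \<Rightarrow> state \<Rightarrow> state \<Rightarrow> real" where
  "jump_rate G A s t =
     (\<Sum>i\<in>dispatchers G. \<Sum>j\<in>servers G.
        if t = s(j := s j @ [i]) then arrival G i * A s i j else 0) +
     (\<Sum>j\<in>servers G.
        if s j \<noteq> [] \<and> t = s(j := tl (s j)) then service G (hd (s j)) j else 0)"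

definition exit_rate :: "lb_system \<Rightarrow> policy \<Rightarrow> state \<Rightarrow> real" where
  "exit_rate G A s =
     (\<Sum>i\<in>dispatchers G. \<Sum>j\<in>servers G. arrival G i * A s i j) +
     (\<Sum>j\<in>servers G. if s j \<noteq> [] then service G (hd (s j)) j else 0)"

definition generator :: "lb_system \<Rightarrow> policy \<Rightarrow> state \<Rightarrow> state \<Rightarrow> real" where
  "generator G A s t = (if s = t then - exit_rate G A s else jump_rate G A s t)"

text \<open>\<open>pool i\<close> is the set of servers to which tasks of type \<open>i\<close> may be assigned.\<close>

definition valid_states :: "lb_system \<Rightarrow> (nat \<Rightarrow> nat set) \<Rightarrow> state set" where
  "valid_states G pool =
     {s. (\<forall>j\<in>servers G. set (s j) \<subseteq> {i \<in> dispatchers G. j \<in> pool i}) \<and>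
         (\<forall>j. j \<notin> servers G \<longrightarrow> s j = [])}"

text \<open>Stationary distributions of the Markov chain with the above generator. In a system with finitely
  many dispatchers and servers the jump rates are bounded, so there is no explosion and stationarity
  is the equation \<open>\<pi> Q = 0\<close>.\<close>

definition steady_state :: "lb_system \<Rightarrow> (nat \<Rightarrow> nat set) \<Rightarrow> policy \<Rightarrow> state pmf \<Rightarrow> bool" where
  "steady_state G pool A \<pi> \<longleftrightarrow>
     set_pmf \<pi> \<subseteq> valid_states G pool \<and>
     (\<forall>t. ((\<lambda>s. pmf \<pi> s * generator G A s t) has_sum 0) UNIV)"

text \<open>Arrivals are independent Poisson processes: an arriving task sees the stationary distribution
  and is of type \<open>i\<close> with probability \<open>\<lambda>\<^sub>i\<close> divided by the total arrival rate.\<close>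

definition prob_join_busy :: "lb_system \<Rightarrow> policy \<Rightarrow> state pmf \<Rightarrow> real" where
  "prob_join_busy G A \<pi> = measure_pmf.expectation \<pi> (\<lambda>s.
     \<Sum>i\<in>dispatchers G. arrival G i / (\<Sum>k\<in>dispatchers G. arrival G k) *
       (\<Sum>j\<in>{j \<in> servers G. s j \<noteq> []}. A s i j))"

definition JIQ :: "(nat \<Rightarrow> nat set) \<Rightarrow> policy" where
  "JIQ pool s i j =
     (let idle = {k \<in> pool i. s k = []};
          targets = (if idle \<noteq> {} then idle else pool i)
      in if j \<in> targets then 1 / real (card targets) else 0)"


section \<open>\<open>f\<close>-sequences and the standing assumptions\<close>

definition f_system ::
  "(nat \<Rightarrow> nat) \<Rightarrow> (nat \<Rightarrow> real) \<Rightarrow> (nat \<Rightarrow> real) \<Rightarrow> (real \<Rightarrow> real) \<Rightarrow> (real \<Rightarrow> real \<Rightarrow> real) \<Rightarrow>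
   nat \<Rightarrow> lb_system" where
  "f_system W \<phi>1 \<phi>2 lam f N =
     \<lparr> dispatchers = {1..W N}, servers = {1..N},
       arrival = (\<lambda>i. lam (\<phi>1 i)), service = (\<lambda>i j. f (\<phi>1 i) (\<phi>2 j)) \<rparr>"

definition f_sequence ::
  "(nat \<Rightarrow> nat) \<Rightarrow> (nat \<Rightarrow> real) \<Rightarrow> (nat \<Rightarrow> real) \<Rightarrow> (real \<Rightarrow> real \<Rightarrow> real) \<Rightarrow> bool" where
  "f_sequence W \<phi>1 \<phi>2 f \<longleftrightarrow>
     mono W \<and> (\<forall>i. \<phi>1 i \<in> {0..<1}) \<and> (\<forall>j. \<phi>2 j \<in> {0..<1}) \<and>
     (\<forall>x\<in>{0..<1}. \<forall>y\<in>{0..<1}. 0 \<le> f x y)"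

text \<open>The rates \<open>\<lambda>\<^sub>i\<close> are point values of \<open>lam\<close>, which Lebesgue integrability does not
  control; ``integrable'' is therefore read as Riemann integrable.\<close>

definition assumption_a :: "(real \<Rightarrow> real) \<Rightarrow> bool" where
  "assumption_a lam \<longleftrightarrow>
     (\<forall>x\<in>{0..<1}. 0 \<le> lam x) \<and> Riemann_integrable_on lam {0..<1} \<and> integral {0..<1} lam > 0"

definition assumption_b :: "(real \<Rightarrow> real \<Rightarrow> real) \<Rightarrow> bool" where
  "assumption_b f \<longleftrightarrow>
     Riemann_integrable_on (\<lambda>(x, y). f x y) ({0..<1} \<times> {0..<1}) \<and>
     (\<exists>\<mu>o>0. \<forall>x\<in>{0..<1}. measure lebesgue {y \<in> {0..<1}. f x y \<ge> \<mu>o} > 0)"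

definition assumption_c :: "(nat \<Rightarrow> nat) \<Rightarrow> (nat \<Rightarrow> real) \<Rightarrow> (nat \<Rightarrow> real) \<Rightarrow> bool" where
  "assumption_c W \<phi>1 \<phi>2 \<longleftrightarrow>
     (\<forall>E. is_interval E \<and> E \<subseteq> {0..<1} \<longrightarrow>
       (\<lambda>N. (\<Sum>i\<in>{1..W N}. indicat_real E (\<phi>1 i)) / real (W N)) \<longlonglongrightarrow> measure lebesgue E \<and>
       (\<lambda>N. (\<Sum>j\<in>{1..N}. indicat_real E (\<phi>2 j)) / real N) \<longlonglongrightarrow> measure lebesgue E)"

definition assumption_d :: "(nat \<Rightarrow> nat) \<Rightarrow> real \<Rightarrow> bool" where
  "assumption_d W \<xi> \<longleftrightarrow> (\<lambda>N. real (W N) / real N) \<longlonglongrightarrow> \<xi> \<and> \<xi> > 0"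


section \<open>The subcritical regime\<close>

definition unit_partition :: "nat \<Rightarrow> (nat \<Rightarrow> real) \<Rightarrow> bool" where
  "unit_partition H w \<longleftrightarrow> w 0 = 0 \<and> w H = 1 \<and> (\<forall>h<H. w h < w (Suc h))"

abbreviation cell :: "(nat \<Rightarrow> real) \<Rightarrow> nat \<Rightarrow> real set" where
  "cell w h \<equiv> {w (h - 1)..<w h}"

text \<open>\<open>\<lambda>\<^sub>h\<close> is the limit of \<open>1/N\<close> times the total arrival rate at the dispatchers of class \<open>h\<close>.
  As \<open>\<xi>\<close> is the limit of \<open>W(N)/N\<close>, this is \<open>\<xi>\<close> times the integral over the cell. The source prints
  the factor \<open>1/\<xi>\<close>, which is inconsistent with \<open>W(N)/N \<longlonglongrightarrow> \<xi>\<close> unless \<open>\<xi> = 1\<close>.\<close>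

definition class_rate :: "real \<Rightarrow> (real \<Rightarrow> real) \<Rightarrow> (nat \<Rightarrow> real) \<Rightarrow> nat \<Rightarrow> real" where
  "class_rate \<xi> lam w h = \<xi> * integral (cell w h) lam"

text \<open>The minimum over a cell is read as an infimum, since it need not be attained.\<close>

definition min_service ::
  "(real \<Rightarrow> real \<Rightarrow> real) \<Rightarrow> (nat \<Rightarrow> real) \<Rightarrow> (nat \<Rightarrow> real) \<Rightarrow> nat \<Rightarrow> nat \<Rightarrow> real" where
  "min_service f w v h m = (INF (x, y)\<in>cell w h \<times> cell v m. f x y)"

text \<open>Division in \<^typ>\<open>ereal\<close> follows the intended convention: \<open>0 / 0 = 0\<close>, and \<open>c / 0 = \<infinity>\<close> for
  \<open>c > 0\<close>. Below this definition the quotients by \<open>min_service\<close> are finite, and division of reals,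
  for which \<open>0 / 0 = 0\<close> as well, is used.\<close>

definition subcritical ::
  "nat \<Rightarrow> nat \<Rightarrow> (nat \<Rightarrow> real) \<Rightarrow> (nat \<Rightarrow> real) \<Rightarrow> (nat \<Rightarrow> nat \<Rightarrow> real) \<Rightarrow>
   real \<Rightarrow> (real \<Rightarrow> real) \<Rightarrow> (real \<Rightarrow> real \<Rightarrow> real) \<Rightarrow> bool" where
  "subcritical H M w v p \<xi> lam f \<longleftrightarrow>
     unit_partition H w \<and> unit_partition M v \<and>
     (\<forall>h\<in>{1..H}. \<forall>m\<in>{1..M}. p h m \<in> {0..<1}) \<and>
     (\<forall>h\<in>{1..H}. (\<Sum>m\<in>{1..M}. p h m) = 1) \<and>
     (\<forall>m\<in>{1..M}. (\<Sum>h\<in>{1..H}. ereal (p h m * class_rate \<xi> lam w h) /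
                     ereal ((v m - v (m - 1)) * min_service f w v h m)) < 1)"


section \<open>ICRD sub-systems\<close>

definition slack ::
  "nat \<Rightarrow> (nat \<Rightarrow> real) \<Rightarrow> (nat \<Rightarrow> real) \<Rightarrow> (nat \<Rightarrow> nat \<Rightarrow> real) \<Rightarrow>
   real \<Rightarrow> (real \<Rightarrow> real) \<Rightarrow> (real \<Rightarrow> real \<Rightarrow> real) \<Rightarrow> nat \<Rightarrow> real" where
  "slack H w v p \<xi> lam f m =
     (v m - v (m - 1)) - (\<Sum>h\<in>{1..H}. class_rate \<xi> lam w h * p h m / min_service f w v h m)"

text \<open>Equality of the ratios means proportionality with a nonzero factor; in particular no row of
  \<open>\<epsilon>\<close> vanishes.\<close>

definition Poly ::
  "nat \<Rightarrow> nat \<Rightarrow> (nat \<Rightarrow> real) \<Rightarrow> (nat \<Rightarrow> real) \<Rightarrow> (nat \<Rightarrow> nat \<Rightarrow> real) \<Rightarrow>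
   real \<Rightarrow> (real \<Rightarrow> real) \<Rightarrow> (real \<Rightarrow> real \<Rightarrow> real) \<Rightarrow> (nat \<Rightarrow> nat \<Rightarrow> real) set" where
  "Poly H M w v p \<xi> lam f =
     {\<epsilon>. (\<forall>h\<in>{1..H}. \<forall>m\<in>{1..M}. \<epsilon> h m \<in> {0..<1}) \<and>
          (\<forall>h\<in>{1..H}. \<exists>c>0. \<forall>m\<in>{1..M}. \<epsilon> h m = c * p h m) \<and>
          (\<forall>m\<in>{1..M}. (\<Sum>h\<in>{1..H}. \<epsilon> h m) \<le> slack H w v p \<xi> lam f m)}"

definition server_class :: "(nat \<Rightarrow> real) \<Rightarrow> (nat \<Rightarrow> real) \<Rightarrow> nat \<Rightarrow> nat \<Rightarrow> nat set" where
  "server_class \<phi>2 v N m = {j \<in> {1..N}. \<phi>2 j \<in> cell v m}"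

text \<open>\<open>V h m\<close> is the part of the \<open>m\<close>-th server class reserved for dispatcher class \<open>h\<close>, and \<open>V 0 m\<close>
  is the remainder. The size of \<open>V 0 m\<close> is determined by the other conditions.\<close>

definition ICRD_division ::
  "nat \<Rightarrow> nat \<Rightarrow> (nat \<Rightarrow> real) \<Rightarrow> (nat \<Rightarrow> real) \<Rightarrow> (nat \<Rightarrow> nat \<Rightarrow> real) \<Rightarrow>
   real \<Rightarrow> (real \<Rightarrow> real) \<Rightarrow> (real \<Rightarrow> real \<Rightarrow> real) \<Rightarrow> (nat \<Rightarrow> nat \<Rightarrow> real) \<Rightarrow> (nat \<Rightarrow> real) \<Rightarrow>
   nat \<Rightarrow> (nat \<Rightarrow> nat \<Rightarrow> nat set) \<Rightarrow> bool" where
  "ICRD_division H M w v p \<xi> lam f \<epsilon> \<phi>2 N V \<longleftrightarrow>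
     (\<forall>m\<in>{1..M}.
        disjoint_family_on (\<lambda>h. V h m) {0..H} \<and>
        (\<Union>h\<in>{0..H}. V h m) = server_class \<phi>2 v N m \<and>
        (\<forall>h\<in>{1..H}. int (card (V h m)) =
           \<lfloor>real N * (class_rate \<xi> lam w h * p h m / min_service f w v h m + \<epsilon> h m)\<rfloor>))"

definition ICRD_pool ::
  "nat \<Rightarrow> nat \<Rightarrow> (nat \<Rightarrow> real) \<Rightarrow> (nat \<Rightarrow> real) \<Rightarrow> (nat \<Rightarrow> nat \<Rightarrow> nat set) \<Rightarrow> nat \<Rightarrow> nat set" where
  "ICRD_pool H M w \<phi>1 V i = (\<Union>h\<in>{h \<in> {1..H}. \<phi>1 i \<in> cell w h}. \<Union>m\<in>{1..M}. V h m)"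

definition restrict_system :: "lb_system \<Rightarrow> (nat \<Rightarrow> nat set) \<Rightarrow> lb_system" where
  "restrict_system G pool =
     G\<lparr>service := (\<lambda>i j. if j \<in> pool i then service G i j else 0)\<rparr>"

end

theory Submission
  imports Defs
begin

text \<open>Fix a dispatcher class with positive limiting rate. In its pool let \<open>Z\<close> be the number of idle
  servers, \<open>T\<close> the number of tasks, \<open>\<Lambda>\<close> the arrival rate and \<open>\<gamma>\<close> a lower bound, of order \<open>N\<close>, for the
  amount by which the service capacity exceeds \<open>\<Lambda>\<close> even when up to \<open>K\<close> servers are idle, with \<open>K\<close> of
  order \<open>N\<close>. For \<open>k \<le> K\<close> consider the Lyapunov function \<open>T + max k Z\<close>. If \<open>Z > k\<close>, it cannot grow: an
  arrival increases \<open>T\<close> and decreases \<open>Z\<close>. If \<open>Z = k\<close>, its drift is at most \<open>\<Lambda>\<close>. If \<open>Z < k\<close>, its drift is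
  the arrival rate minus the departure rate, hence at most \<open>- \<gamma>\<close>. As the mean drift vanishes in steady
  state, \<open>\<gamma> P(Z = 0) \<le> \<Lambda> P(Z = k)\<close>; summing over \<open>k\<close> gives \<open>\<gamma> K P(Z = 0) \<le> \<Lambda>\<close>, so that \<open>P(Z = 0)\<close> is of
  order \<open>1 / N\<close>. Classes with limiting rate \<open>0\<close> receive a vanishing share of the arrivals.\<close>

section \<open>Stationarity tested against bounded functions\<close>

text \<open>Translates between the \<open>has_sum\<close> form of stationarity and expectations:
  \<open>pmf \<pi>\<close> is the density of \<open>\<pi>\<close> with respect to counting measure.
  The bound is asked only on the support because service rates are controlled only in valid
  states.\<close>

lemma has_sum_pmf_expectation:
  fixes u :: "'a \<Rightarrow> real"
  assumes "\<And>s. s \<in> set_pmf \<pi> \<Longrightarrow> \<bar>u s\<bar> \<le> C"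
  shows "((\<lambda>s. pmf \<pi> s * u s) has_sum measure_pmf.expectation \<pi> u) UNIV"
proof -
  have "integrable (measure_pmf \<pi>) u"
    by (rule measure_pmf.integrable_const_bound[where B = C]) (auto intro: AE_pmfI assms)
  then have "integrable (count_space UNIV) (\<lambda>s. pmf \<pi> s * u s)"
    by (simp add: measure_pmf_eq_density integrable_density)
  then have abs: "Infinite_Set_Sum.abs_summable_on (\<lambda>s. pmf \<pi> s * u s) UNIV"
    by (simp add: Infinite_Set_Sum.abs_summable_on_def)
  have "measure_pmf.expectation \<pi> u = (\<integral>s. pmf \<pi> s * u s \<partial>count_space UNIV)"
    by (simp add: measure_pmf_eq_density integral_density)
  also have "\<dots> = (\<Sum>\<^sub>\<infinity>s. pmf \<pi> s * u s)"
    using infsetsum_infsum[OF abs] by (simp add: infsetsum_def)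
  finally have "measure_pmf.expectation \<pi> u = (\<Sum>\<^sub>\<infinity>s. pmf \<pi> s * u s)" .
  moreover have "(\<lambda>s. pmf \<pi> s * u s) summable_on UNIV"
    using abs abs_summable_equivalent abs_summable_summable by blast
  ultimately show ?thesis
    by (simp add: has_sum_infsum)
qed

lemma has_sum_sum:
  fixes F :: "'e \<Rightarrow> 'a \<Rightarrow> real"
  assumes "finite E" and "\<And>e. e \<in> E \<Longrightarrow> (F e has_sum S e) X"
  shows "((\<lambda>x. \<Sum>e\<in>E. F e x) has_sum (\<Sum>e\<in>E. S e)) X"
  using assms by (induction E rule: finite_induct) (auto intro: has_sum_add)

text \<open>The double family is supported on the graph of \<open>\<tau>\<close>, where reindexing
  by \<open>s\<close> turns it into the series of an expectation. Summability over pairs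
  \<open>(t, s)\<close> is what later allows a change in the order of summation.\<close>

lemma has_sum_transition:
  fixes \<rho> g :: "'a \<Rightarrow> real"
  assumes \<rho>: "\<And>s. s \<in> set_pmf \<pi> \<Longrightarrow> \<bar>\<rho> s\<bar> \<le> C" and g: "\<And>t. \<bar>g t\<bar> \<le> B"
  shows "((\<lambda>(t, s). g t * (pmf \<pi> s * (\<rho> s * of_bool (t = \<tau> s)))) has_sum
           measure_pmf.expectation \<pi> (\<lambda>s. \<rho> s * g (\<tau> s))) (UNIV \<times> UNIV)"
proof -
  have "((\<lambda>s. pmf \<pi> s * (\<rho> s * g (\<tau> s))) has_sum
      measure_pmf.expectation \<pi> (\<lambda>s. \<rho> s * g (\<tau> s))) UNIV"
    by (rule has_sum_pmf_expectation[where C = "C * B"])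
       (use \<rho> g in \<open>auto simp: abs_mult intro!: mult_mono order_trans[OF abs_ge_zero]\<close>)
  also have "(\<lambda>s. pmf \<pi> s * (\<rho> s * g (\<tau> s))) =
      (\<lambda>(t, s). g t * (pmf \<pi> s * (\<rho> s * of_bool (t = \<tau> s)))) \<circ> (\<lambda>s. (\<tau> s, s))"
    by (auto simp: fun_eq_iff)
  finally have "((\<lambda>(t, s). g t * (pmf \<pi> s * (\<rho> s * of_bool (t = \<tau> s)))) has_sum
      measure_pmf.expectation \<pi> (\<lambda>s. \<rho> s * g (\<tau> s))) (range (\<lambda>s. (\<tau> s, s)))"
    by (intro has_sum_reindex[THEN iffD2]) (auto simp: inj_on_def o_def)
  then show ?thesis
    by (rule has_sum_cong_neutral[THEN iffD1, rotated -1]) auto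
qed

text \<open>Multiply the balance equation of state \<open>t\<close> by \<open>g t\<close> and sum
  over \<open>t\<close>: by joint summability, summing over \<open>s\<close> first gives 0, while
  the sum over pairs is the expectation. Each event \<open>e\<close> contributes a gain at
  \<open>\<tau> e s\<close> and a loss at \<open>s\<close>.\<close>

lemma has_bochner_integral_transitions:
  fixes \<rho> :: "'e \<Rightarrow> 'a \<Rightarrow> real"
  assumes E: "finite E"
    and \<rho>: "\<And>e s. e \<in> E \<Longrightarrow> s \<in> set_pmf \<pi> \<Longrightarrow> \<bar>\<rho> e s\<bar> \<le> C e"
    and g: "\<And>t. \<bar>g t\<bar> \<le> B"
    and stat: "\<And>t. ((\<lambda>s. pmf \<pi> s * (\<Sum>e\<in>E. \<rho> e s * (of_bool (t = \<tau> e s) - of_bool (t = s))))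
                 has_sum 0) UNIV"
  shows "has_bochner_integral (measure_pmf \<pi>) (\<lambda>s. \<Sum>e\<in>E. \<rho> e s * (g (\<tau> e s) - g s)) 0"
proof -
  let ?E = "measure_pmf.expectation \<pi>"
  have int: "integrable (measure_pmf \<pi>) (\<lambda>s. \<rho> e s * g (\<sigma> s))" if "e \<in> E" for e \<sigma>
    by (rule measure_pmf.integrable_const_bound[where B = "C e * B"])
       (use \<rho> g that in \<open>auto simp: abs_mult intro!: AE_pmfI mult_mono order_trans[OF abs_ge_zero]\<close>)
  have "((\<lambda>(t, s). \<Sum>e\<in>E. g t * (pmf \<pi> s * (\<rho> e s * of_bool (t = \<tau> e s))) +
             - (g t * (pmf \<pi> s * (\<rho> e s * of_bool (t = s))))) has_sum
           (\<Sum>e\<in>E. ?E (\<lambda>s. \<rho> e s * g (\<tau> e s)) + - ?E (\<lambda>s. \<rho> e s * g s))) (UNIV \<times> UNIV)"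
    unfolding case_prod_unfold
    apply (rule has_sum_sum[OF E])
    apply (rule has_sum_add)
    subgoal for e
      using has_sum_transition[where \<rho> = "\<rho> e" and \<tau> = "\<tau> e", OF \<rho> g] by (simp add: case_prod_unfold)
    subgoal for e
      using has_sum_transition[where \<rho> = "\<rho> e" and \<tau> = "\<lambda>s. s", OF \<rho> g]
      by (simp add: case_prod_unfold has_sum_uminus)
    done
  then have "((\<lambda>(t, s). g t * (pmf \<pi> s * (\<Sum>e\<in>E. \<rho> e s * (of_bool (t = \<tau> e s) - of_bool (t = s)))))
      has_sum (\<Sum>e\<in>E. ?E (\<lambda>s. \<rho> e s * g (\<tau> e s)) + - ?E (\<lambda>s. \<rho> e s * g s))) (UNIV \<times> UNIV)"
    by (simp add: sum_distrib_left algebra_simps)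
  \<comment> \<open>The inner sums over \<open>s\<close> are the balance equations, so each is
    \<open>g t * 0\<close>.\<close>
  then have "((\<lambda>t. g t * 0) has_sum (\<Sum>e\<in>E. ?E (\<lambda>s. \<rho> e s * g (\<tau> e s)) + - ?E (\<lambda>s. \<rho> e s * g s))) UNIV"
    by (rule has_sum_SigmaD) (unfold prod.case, rule has_sum_cmult_right, rule stat)
  then have "(\<Sum>e\<in>E. ?E (\<lambda>s. \<rho> e s * g (\<tau> e s)) + - ?E (\<lambda>s. \<rho> e s * g s)) = 0"
    by (intro has_sum_unique[OF _ has_sum_0_simp]) simp
  moreover have "?E (\<lambda>s. \<Sum>e\<in>E. \<rho> e s * (g (\<tau> e s) - g s)) =
      (\<Sum>e\<in>E. ?E (\<lambda>s. \<rho> e s * g (\<tau> e s)) + - ?E (\<lambda>s. \<rho> e s * g s))"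
    using int[of _ "\<tau> _"] int[of _ "\<lambda>s. s"]
    by (subst Bochner_Integration.integral_sum) (auto simp: right_diff_distrib)
  moreover have "integrable (measure_pmf \<pi>) (\<lambda>s. \<Sum>e\<in>E. \<rho> e s * (g (\<tau> e s) - g s))"
    using int[of _ "\<tau> _"] int[of _ "\<lambda>s. s"]
    by (intro Bochner_Integration.integrable_sum) (auto simp: right_diff_distrib)
  ultimately show ?thesis by (simp add: has_bochner_integral_iff)
qed

text \<open>The generator applied to \<open>g\<close>, organised by events rather than target
  states, so that only finite sums occur.\<close>

definition drift :: "lb_system \<Rightarrow> policy \<Rightarrow> (state \<Rightarrow> real) \<Rightarrow> state \<Rightarrow> real" where
  "drift G A g s =
     (\<Sum>i\<in>dispatchers G. \<Sum>j\<in>servers G. arrival G i * A s i j * (g (s(j := s j @ [i])) - g s)) +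
     (\<Sum>j\<in>servers G. (if s j \<noteq> [] then service G (hd (s j)) j else 0) * (g (s(j := tl (s j))) - g s))"

text \<open>Appending or removing a task changes the queue length, so no event fixes the state and
  for \<open>t = s\<close> the events add up to minus the exit rate. Removal from an empty queue
  would fix it, but has rate 0.\<close>

lemma generator_eq_drift: "generator G A s t = drift G A (\<lambda>u. of_bool (t = u)) s"
proof (cases "t = s")
  case True
  have "s \<noteq> s(j := s j @ [i])" for i j
    by (metis fun_upd_same self_append_conv not_Cons_self2)
  moreover have "s \<noteq> s(j := tl (s j))" if "s j \<noteq> []" for j
    using that by (metis fun_upd_same length_tl list.collapse not_Cons_self2)
  ultimately show ?thesis
    using True
    by (auto simp: generator_def drift_def exit_rate_def sum_negf intro!: sum.cong
        arg_cong2[where f = "(+)"] simp flip: sum_negf)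
next
  case False
  then show ?thesis
    by (auto simp: generator_def drift_def jump_rate_def intro!: sum.cong
        arg_cong2[where f = "(+)"])
qed

text \<open>Service rates are bounded on the support, since in a valid state the task in service has
  one of finitely many types. The events are the arrivals \<open>(i, j)\<close> and the departures
  \<open>j\<close>.\<close>

lemma has_bochner_integral_drift:
  assumes fin: "finite (dispatchers G)" "finite (servers G)"
    and stat: "steady_state G pool A \<pi>"
    and A: "\<And>s i j. \<bar>A s i j\<bar> \<le> 1"
    and g: "\<And>t. \<bar>g t\<bar> \<le> B"
  shows "has_bochner_integral (measure_pmf \<pi>) (drift G A g) 0"
proof -
  define E where "E = (dispatchers G \<times> servers G) <+> servers G"
  define \<rho> where "\<rho> = case_sum (\<lambda>(i, j) s. arrival G i * A s i j)
    (\<lambda>j s. if s j \<noteq> [] then service G (hd (s j)) j else 0)"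
  define \<tau> :: "nat \<times> nat + nat \<Rightarrow> state \<Rightarrow> state" where
    "\<tau> = case_sum (\<lambda>(i, j) s. s(j := s j @ [i])) (\<lambda>j s. s(j := tl (s j)))"
  \<comment> \<open>The type in service varies with the state, so the bound for a departure adds up
    the rates of all types.\<close>
  define C :: "nat \<times> nat + nat \<Rightarrow> real" where "C = case_sum (\<lambda>(i, j). \<bar>arrival G i\<bar>)
    (\<lambda>j. \<Sum>i\<in>dispatchers G. \<bar>service G i j\<bar>)"
  have E: "finite E" using fin by (auto simp: E_def)
  have drift: "drift G A h s = (\<Sum>e\<in>E. \<rho> e s * (h (\<tau> e s) - h s))" for h s
    using fin unfolding E_def
    by (subst sum.Plus) (auto simp: drift_def \<rho>_def \<tau>_def sum.cartesian_product intro!: sum.cong)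
  have valid: "set_pmf \<pi> \<subseteq> valid_states G pool"
    using stat by (simp add: steady_state_def)
  have "has_bochner_integral (measure_pmf \<pi>) (\<lambda>s. \<Sum>e\<in>E. \<rho> e s * (g (\<tau> e s) - g s)) 0"
  proof (rule has_bochner_integral_transitions[where C = C and B = B])
    fix e s assume e: "e \<in> E" and s: "s \<in> set_pmf \<pi>"
    show "\<bar>\<rho> e s\<bar> \<le> C e"
    proof (cases e)
      case (Inl ij)
      then show ?thesis
        using A by (cases ij) (auto simp: \<rho>_def C_def abs_mult mult_left_le)
    next
      case (Inr j)
      then have j: "j \<in> servers G" using e by (auto simp: E_def)
      have "hd (s j) \<in> dispatchers G" if "s j \<noteq> []"
        using valid s j hd_in_set[OF that] by (auto simp: valid_states_def)
      then have "\<bar>service G (hd (s j)) j\<bar> \<le> (\<Sum>i\<in>dispatchers G. \<bar>service G i j\<bar>)" if "s j \<noteq> []"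
        using that fin by (intro member_le_sum[of _ _ "\<lambda>i. \<bar>service G i j\<bar>"]) auto
      then show ?thesis
        by (auto simp: \<rho>_def C_def Inr sum_nonneg)
    qed
  next
    show "finite E" by (fact E)
    show "\<bar>g t\<bar> \<le> B" for t by (fact g)
  next
    fix t
    have "((\<lambda>s. pmf \<pi> s * generator G A s t) has_sum 0) UNIV"
      using stat by (simp add: steady_state_def)
    then show "((\<lambda>s. pmf \<pi> s * (\<Sum>e\<in>E. \<rho> e s * (of_bool (t = \<tau> e s) - of_bool (t = s)))) has_sum 0) UNIV"
      by (simp add: generator_eq_drift drift)
  qed
  then show ?thesis
    by (simp add: drift[abs_def])
qed


section \<open>The drift in a single pool\<close>

lemma JIQ_nonneg: "0 \<le> JIQ pool s i j"
  by (simp add: JIQ_def Let_def)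

lemma JIQ_le_1: "JIQ pool s i j \<le> 1"
proof -
  have "1 / real n \<le> 1" for n
    by (cases n) auto
  then show ?thesis by (simp add: JIQ_def Let_def)
qed

text \<open>Equality may fail: \<open>J\<close> need not contain all targets, and for an empty or
  infinite target set all the probabilities are 0.\<close>

lemma sum_JIQ_le_1:
  assumes "finite J"
  shows "(\<Sum>j\<in>J. JIQ pool s i j) \<le> 1"
proof -
  define T where "T = (let idle = {k \<in> pool i. s k = []} in if idle \<noteq> {} then idle else pool i)"
  have "(\<Sum>j\<in>J. JIQ pool s i j) = (\<Sum>j\<in>J. if j \<in> T then 1 / real (card T) else 0)"
    unfolding JIQ_def T_def Let_def by (rule refl)
  also have "\<dots> = real (card (J \<inter> T)) / real (card T)"
    using assms by (simp add: sum.If_cases Int_def)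
  also have "\<dots> \<le> 1"
    by (cases "finite T") (auto simp: divide_le_eq_1 card_gt_0_iff intro: card_mono)
  finally show ?thesis .
qed

lemma JIQ_busy_eq_0:
  assumes "k \<in> pool i" "s k = []" "s j \<noteq> []"
  shows "JIQ pool s i j = 0"
  using assms by (auto simp: JIQ_def Let_def)

lemma JIQ_outside_pool_eq_0: "j \<notin> pool i \<Longrightarrow> JIQ pool s i j = 0"
  by (auto simp: JIQ_def Let_def)

section \<open>The Lyapunov function and its increments\<close>

definition idle_count :: "nat set \<Rightarrow> state \<Rightarrow> nat" where
  "idle_count P s = (\<Sum>j\<in>P. of_bool (s j = []))"

definition task_count :: "nat set \<Rightarrow> state \<Rightarrow> nat" where
  "task_count P s = (\<Sum>j\<in>P. length (s j))"

definition energy :: "nat set \<Rightarrow> nat \<Rightarrow> state \<Rightarrow> nat" where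
  "energy P k s = task_count P s + max k (idle_count P s)"

lemma idle_count_eq_card: "finite P \<Longrightarrow> idle_count P s = card {j \<in> P. s j = []}"
  by (simp add: idle_count_def of_bool_def flip: sum.inter_filter)

text \<open>Serves both counters, with \<open>q\<close> the queue length or the indicator of an
  empty queue. The additive form avoids truncated subtraction in \<open>nat\<close>.\<close>

lemma sum_fun_upd_add:
  fixes q :: "'b \<Rightarrow> nat"
  assumes "finite P" "j \<in> P"
  shows "(\<Sum>l\<in>P. q ((s(j := x)) l)) + q (s j) = (\<Sum>l\<in>P. q (s l)) + q x"
proof -
  have "(\<Sum>l\<in>P - {j}. q ((s(j := x)) l)) = (\<Sum>l\<in>P - {j}. q (s l))"
    by (intro sum.cong) auto
  then show ?thesis
    using assms by (simp add: sum.remove[of P j])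
qed

lemma energy_fun_upd_outside:
  assumes "j \<notin> P"
  shows "energy P k (s(j := x)) = energy P k s"
proof -
  have "task_count P (s(j := x)) = task_count P s" "idle_count P (s(j := x)) = idle_count P s"
    unfolding task_count_def idle_count_def by (intro sum.cong; use assms in auto)+
  then show ?thesis by (simp add: energy_def)
qed

text \<open>An arrival at an idle server lowers \<open>idle_count\<close> by one, which offsets the
  new task in the maximum exactly when \<open>idle_count\<close> exceeds \<open>k\<close>. With no
  idle server \<open>idle_count\<close> stays 0. Within the pool, JIQ makes only assignments of
  these two kinds.\<close>

lemma energy_arrival:
  assumes "finite P" "j \<in> P" and "s j = [] \<or> idle_count P s = 0"
  shows "energy P k (s(j := s j @ [i])) = energy P k s + of_bool (idle_count P s \<le> k)"
proof -
  have "idle_count P (s(j := s j @ [i])) + of_bool (s j = []) = idle_count P s"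
    using sum_fun_upd_add[OF assms(1,2), of "\<lambda>x. of_bool (x = [])" s "s j @ [i]"]
    by (simp add: idle_count_def)
  moreover have "task_count P (s(j := s j @ [i])) = task_count P s + 1"
    using sum_fun_upd_add[OF assms(1,2), of length s "s j @ [i]"] by (simp add: task_count_def)
  ultimately show ?thesis
    using assms(3) by (auto simp: energy_def of_bool_def max_def split: if_splits)
qed

text \<open>A departure frees at most one server. Below level \<open>k\<close> the maximum stays at
  \<open>k\<close> and the lost task counts in full; otherwise a newly idle server can at most
  cancel it.\<close>

lemma energy_departure:
  assumes "finite P" "j \<in> P" and "s j \<noteq> []"
  shows "energy P k (s(j := tl (s j))) + of_bool (idle_count P s < k) \<le> energy P k s"
proof -
  have "idle_count P (s(j := tl (s j))) = idle_count P s + of_bool (tl (s j) = [])"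
    using sum_fun_upd_add[OF assms(1,2), of "\<lambda>x. of_bool (x = [])" s "tl (s j)"] assms(3)
    by (simp add: idle_count_def)
  moreover have "task_count P (s(j := tl (s j))) + 1 = task_count P s"
    using sum_fun_upd_add[OF assms(1,2), of length s "tl (s j)"] assms(3)
    by (cases "s j") (auto simp: task_count_def)
  ultimately show ?thesis
    by (auto simp: energy_def of_bool_def max_def split: if_splits)
qed

text \<open>Only types in \<open>C\<close> can join or be served in \<open>P\<close>, so the drift
  is that of an isolated pool. The bounds \<open>\<mu> j\<close> depend on the server alone, hence
  apply whatever the type in service. Cutting off at \<open>B\<close> keeps the test function
  bounded.\<close>

lemma drift_energy_le:
  assumes fin: "finite (dispatchers G)" "finite (servers G)"
    and P: "P \<subseteq> servers G" and C: "C \<subseteq> dispatchers G"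
    and poolC: "\<And>i. i \<in> C \<Longrightarrow> pool i = P"
    and pool_disj: "\<And>i. i \<in> dispatchers G - C \<Longrightarrow> pool i \<inter> P = {}"
    and arrival: "\<And>i. i \<in> dispatchers G \<Longrightarrow> 0 \<le> arrival G i"
    and service: "\<And>i j. i \<in> C \<Longrightarrow> j \<in> P \<Longrightarrow> \<mu> j \<le> service G i j"
    and \<mu>: "\<And>j. j \<in> P \<Longrightarrow> 0 \<le> \<mu> j"
    and cap: "\<And>Q. Q \<subseteq> P \<Longrightarrow> card Q < k \<Longrightarrow> (\<Sum>i\<in>C. arrival G i) + \<gamma> \<le> (\<Sum>j\<in>P - Q. \<mu> j)"
    and s: "s \<in> valid_states G pool"
  shows "drift G (JIQ pool) (\<lambda>t. real (min (energy P k t) B)) s \<le>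
    (\<Sum>i\<in>C. arrival G i) * of_bool (idle_count P s = k) -
    \<gamma> * of_bool (idle_count P s < k \<and> energy P k s < B)"
proof -
  let ?g = "\<lambda>t. real (min (energy P k t) B)"
  define \<Lambda> where "\<Lambda> = (\<Sum>i\<in>C. arrival G i)"
  \<comment> \<open>\<open>X\<close> is the gain from an arrival in the pool and \<open>Y\<close> a
    lower bound for the loss from a departure; they can differ only when
    \<open>idle_count P s = k\<close>. A departure at energy exactly \<open>B\<close> can only help
    and is left out of \<open>Y\<close>.\<close>
  define X :: real where "X = of_bool (idle_count P s \<le> k \<and> energy P k s < B)"
  define Y :: real where "Y = of_bool (idle_count P s < k \<and> energy P k s < B)"
  define Q where "Q = {j \<in> P. s j = []}"
  have finP: "finite P" using fin P finite_subset by blast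
  have idle0: "idle_count P s = 0 \<longleftrightarrow> (\<forall>j\<in>P. s j \<noteq> [])"
    using finP by (auto simp: idle_count_def)
  have "(\<Sum>j\<in>servers G. arrival G i * JIQ pool s i j * (?g (s(j := s j @ [i])) - ?g s)) \<le>
      (if i \<in> C then arrival G i * X else 0)" if i: "i \<in> dispatchers G" for i
  proof (cases "i \<in> C")
    case False
    have "JIQ pool s i j * (?g (s(j := s j @ [i])) - ?g s) = 0" for j
      using pool_disj[of i] i False
      by (cases "j \<in> P") (auto simp: energy_fun_upd_outside intro!: JIQ_outside_pool_eq_0)
    then show ?thesis
      using False by (simp only: mult.assoc mult_zero_right sum.neutral_const if_False)
  next
    case True
    have *: "JIQ pool s i j * (?g (s(j := s j @ [i])) - ?g s) \<le> JIQ pool s i j * X" for j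
    proof (cases "j \<in> P \<and> (s j = [] \<or> idle_count P s = 0)")
      case True
      then show ?thesis
        using energy_arrival[OF finP, of j s k i]
        by (intro mult_left_mono JIQ_nonneg) (auto simp: X_def of_bool_def)
    next
      case False
      then have "JIQ pool s i j = 0"
        using poolC[OF True] idle0 by (auto intro: JIQ_outside_pool_eq_0 JIQ_busy_eq_0)
      then show ?thesis by simp
    qed
    have "(\<Sum>j\<in>servers G. arrival G i * JIQ pool s i j * (?g (s(j := s j @ [i])) - ?g s)) \<le>
        (\<Sum>j\<in>servers G. arrival G i * (JIQ pool s i j * X))"
      unfolding mult.assoc by (intro sum_mono mult_left_mono[OF *] arrival i)
    also have "\<dots> = arrival G i * ((\<Sum>j\<in>servers G. JIQ pool s i j) * X)"
      by (simp add: sum_distrib_left sum_distrib_right)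
    also have "\<dots> \<le> arrival G i * (1 * X)"
      by (intro mult_left_mono mult_right_mono sum_JIQ_le_1 fin arrival i) (simp add: X_def)
    finally show ?thesis using True by simp
  qed
  then have "(\<Sum>i\<in>dispatchers G. \<Sum>j\<in>servers G.
      arrival G i * JIQ pool s i j * (?g (s(j := s j @ [i])) - ?g s)) \<le>
      (\<Sum>i\<in>dispatchers G. if i \<in> C then arrival G i * X else 0)"
    by (intro sum_mono)
  also have "\<dots> = \<Lambda> * X"
    using C fin by (simp add: \<Lambda>_def sum_distrib_right Int_absorb1 flip: sum.inter_restrict)
  finally have arr: "(\<Sum>i\<in>dispatchers G. \<Sum>j\<in>servers G.
      arrival G i * JIQ pool s i j * (?g (s(j := s j @ [i])) - ?g s)) \<le> \<Lambda> * X" .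
  have "(if s j \<noteq> [] then service G (hd (s j)) j else 0) * (?g (s(j := tl (s j))) - ?g s) \<le>
      (if j \<in> P - Q then - (\<mu> j * Y) else 0)" if j: "j \<in> servers G" for j
  proof (cases "j \<in> P - Q")
    case False
    then show ?thesis by (auto simp: Q_def energy_fun_upd_outside)
  next
    case True
    then have jP: "j \<in> P" "s j \<noteq> []" by (auto simp: Q_def)
    \<comment> \<open>Validity of the state enters here: the type in service has \<open>j\<close> in
      its pool, so disjointness of the pools puts it in \<open>C\<close>.\<close>
    have "hd (s j) \<in> dispatchers G" "j \<in> pool (hd (s j))"
      using s j hd_in_set[OF jP(2)] by (auto simp: valid_states_def)
    with pool_disj jP have "hd (s j) \<in> C" by blast
    then have "\<mu> j \<le> service G (hd (s j)) j"
      by (intro service jP)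
    then have "\<mu> j * Y \<le> service G (hd (s j)) j * (?g s - ?g (s(j := tl (s j))))"
      using energy_departure[of P j s k, OF finP jP] \<mu>[OF jP(1)]
      by (intro mult_mono) (auto simp: Y_def of_bool_def split: if_splits)
    then show ?thesis using True jP by (simp add: algebra_simps)
  qed
  then have "(\<Sum>j\<in>servers G.
      (if s j \<noteq> [] then service G (hd (s j)) j else 0) * (?g (s(j := tl (s j))) - ?g s)) \<le>
      (\<Sum>j\<in>servers G. if j \<in> P - Q then - (\<mu> j * Y) else 0)"
    by (intro sum_mono)
  also have "\<dots> = - (\<Sum>j\<in>P - Q. \<mu> j * Y)"
  proof -
    have "servers G \<inter> (P - Q) = P - Q" using P by blast
    then show ?thesis
      using sum.inter_restrict[OF fin(2), of "\<lambda>j. - (\<mu> j * Y)" "P - Q"] by (simp only: sum_negf)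
  qed
  also have "\<dots> = - (\<Sum>j\<in>P - Q. \<mu> j) * Y"
    by (simp add: sum_distrib_right)
  finally have dep: "(\<Sum>j\<in>servers G.
      (if s j \<noteq> [] then service G (hd (s j)) j else 0) * (?g (s(j := tl (s j))) - ?g s)) \<le>
      - (\<Sum>j\<in>P - Q. \<mu> j) * Y" .
  have "0 \<le> \<Lambda>"
    unfolding \<Lambda>_def using C arrival by (intro sum_nonneg) auto
  moreover have "\<Lambda> + \<gamma> \<le> (\<Sum>j\<in>P - Q. \<mu> j)" if "idle_count P s < k"
    using that cap[of Q] finP by (auto simp: Q_def \<Lambda>_def idle_count_eq_card)
  \<comment> \<open>Below level \<open>k\<close>, \<open>X = Y\<close> and the spare capacity gives
    \<open>- \<gamma> * Y\<close>; at level \<open>k\<close>, \<open>Y = 0\<close> and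
    \<open>X \<le> 1\<close>; above it both vanish.\<close>
  ultimately have "\<Lambda> * X - (\<Sum>j\<in>P - Q. \<mu> j) * Y \<le> \<Lambda> * of_bool (idle_count P s = k) - \<gamma> * Y"
    by (cases "idle_count P s" k rule: linorder_cases) (auto simp: X_def Y_def of_bool_def)
  then show ?thesis
    using arr dep by (simp add: drift_def \<Lambda>_def Y_def)
qed

text \<open>The levels \<open>idle_count P s = k\<close> for \<open>k\<close> in
  \<open>{1..K}\<close> are disjoint events, so summing the \<open>K\<close> drift inequalities
  produces the factor \<open>K\<close> at the cost of a single \<open>\<Lambda>\<close>. The number
  of tasks may have infinite mean: the cutoff parameter \<open>b\<close> is sent to infinity only in
  the resulting inequality.\<close>

lemma prob_all_busy_le:
  assumes fin: "finite (dispatchers G)" "finite (servers G)"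
    and stat: "steady_state G pool (JIQ pool) \<pi>"
    and P: "P \<subseteq> servers G" and C: "C \<subseteq> dispatchers G"
    and poolC: "\<And>i. i \<in> C \<Longrightarrow> pool i = P"
    and pool_disj: "\<And>i. i \<in> dispatchers G - C \<Longrightarrow> pool i \<inter> P = {}"
    and arrival: "\<And>i. i \<in> dispatchers G \<Longrightarrow> 0 \<le> arrival G i"
    and service: "\<And>i j. i \<in> C \<Longrightarrow> j \<in> P \<Longrightarrow> \<mu> j \<le> service G i j"
    and \<mu>: "\<And>j. j \<in> P \<Longrightarrow> 0 \<le> \<mu> j"
    and cap: "\<And>Q. Q \<subseteq> P \<Longrightarrow> card Q < K \<Longrightarrow> (\<Sum>i\<in>C. arrival G i) + \<gamma> \<le> (\<Sum>j\<in>P - Q. \<mu> j)"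
    and \<gamma>: "0 \<le> \<gamma>"
  shows "\<gamma> * real K * measure_pmf.prob \<pi> {s. \<forall>j\<in>P. s j \<noteq> []} \<le> (\<Sum>i\<in>C. arrival G i)"
proof -
  define \<Lambda> where "\<Lambda> = (\<Sum>i\<in>C. arrival G i)"
  have finP: "finite P" using fin P finite_subset by blast
  have idle0: "idle_count P s = 0 \<longleftrightarrow> (\<forall>j\<in>P. s j \<noteq> [])" for s
    using finP by (auto simp: idle_count_def)
  have \<Lambda>0: "0 \<le> \<Lambda>"
    unfolding \<Lambda>_def using C arrival by (intro sum_nonneg) auto
  have step: "\<gamma> * measure_pmf.prob \<pi> {s. idle_count P s = 0 \<and> task_count P s < b} \<le>
      \<Lambda> * measure_pmf.prob \<pi> {s. idle_count P s = k}" if k: "k \<in> {1..K}" for k b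
  proof -
    let ?A = "{s. idle_count P s < k \<and> energy P k s < b + k}"
    let ?B = "{s. idle_count P s = k}"
    \<comment> \<open>The energy is unbounded, so it is cut off at \<open>b + k\<close>; above the cutoff the drift is nonpositive.\<close>
    let ?d = "drift G (JIQ pool) (\<lambda>t. real (min (energy P k t) (b + k)))"
    have int: "has_bochner_integral (measure_pmf \<pi>) ?d 0"
      by (intro has_bochner_integral_drift[where B = "real (b + k)", OF fin stat])
         (auto simp: abs_of_nonneg JIQ_nonneg JIQ_le_1)
    have int': "integrable (measure_pmf \<pi>) (indicat_real A)" for A
      by (rule measure_pmf.integrable_const_bound[where B = 1]) auto
    have "0 = measure_pmf.expectation \<pi> ?d"
      using int by (simp add: has_bochner_integral_iff)
    also have "\<dots> \<le> measure_pmf.expectation \<pi> (\<lambda>s. \<Lambda> * indicat_real ?B s - \<gamma> * indicat_real ?A s)"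
    proof (rule integral_mono_AE)
      show "AE s in measure_pmf \<pi>. ?d s \<le> \<Lambda> * indicat_real ?B s - \<gamma> * indicat_real ?A s"
      proof (rule AE_pmfI)
        fix s assume "s \<in> set_pmf \<pi>"
        then have "s \<in> valid_states G pool"
          using stat by (auto simp: steady_state_def)
        then have "?d s \<le> (\<Sum>i\<in>C. arrival G i) * of_bool (idle_count P s = k) -
            \<gamma> * of_bool (idle_count P s < k \<and> energy P k s < b + k)"
          using k by (intro drift_energy_le[where \<mu> = \<mu>] fin P C poolC pool_disj arrival service \<mu> cap) auto
        then show "?d s \<le> \<Lambda> * indicat_real ?B s - \<gamma> * indicat_real ?A s"
          by (simp add: \<Lambda>_def indicator_def of_bool_def)
      qed
    qed (use int int' in \<open>auto simp: has_bochner_integral_iff\<close>)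
    also have "\<dots> = \<Lambda> * measure_pmf.prob \<pi> ?B - \<gamma> * measure_pmf.prob \<pi> ?A"
      using int' by simp
    finally have "\<gamma> * measure_pmf.prob \<pi> ?A \<le> \<Lambda> * measure_pmf.prob \<pi> ?B" by simp
    \<comment> \<open>When all servers are busy, the energy equals
      \<open>task_count P s + k\<close>, and \<open>0 < k\<close> because levels start at 1.\<close>
    moreover have "measure_pmf.prob \<pi> {s. idle_count P s = 0 \<and> task_count P s < b} \<le>
        measure_pmf.prob \<pi> ?A"
      using k by (intro measure_pmf.finite_measure_mono) (auto simp: energy_def)
    ultimately show ?thesis
      using \<gamma> by (meson mult_left_mono order_trans)
  qed
  have bound: "\<gamma> * real K * measure_pmf.prob \<pi> {s. idle_count P s = 0 \<and> task_count P s < b} \<le> \<Lambda>" for b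
  proof -
    have "\<gamma> * real K * measure_pmf.prob \<pi> {s. idle_count P s = 0 \<and> task_count P s < b} =
        (\<Sum>k\<in>{1..K}. \<gamma> * measure_pmf.prob \<pi> {s. idle_count P s = 0 \<and> task_count P s < b})"
      by simp
    also have "\<dots> \<le> (\<Sum>k\<in>{1..K}. \<Lambda> * measure_pmf.prob \<pi> {s. idle_count P s = k})"
      by (intro sum_mono step)
    also have "\<dots> = \<Lambda> * measure_pmf.prob \<pi> (\<Union>k\<in>{1..K}. {s. idle_count P s = k})"
      by (subst measure_pmf.finite_measure_finite_Union)
         (auto simp: disjoint_family_on_def sum_distrib_left)
    also have "\<dots> \<le> \<Lambda> * 1"
      by (intro mult_left_mono \<Lambda>0) simp
    finally show ?thesis by simp
  qed
  \<comment> \<open>Every state has finitely many tasks, so these events increase to the one with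
    all servers of \<open>P\<close> busy.\<close>
  have "(\<lambda>b. measure_pmf.prob \<pi> {s. idle_count P s = 0 \<and> task_count P s < b}) \<longlonglongrightarrow>
      measure_pmf.prob \<pi> (\<Union>b. {s. idle_count P s = 0 \<and> task_count P s < b})"
    by (intro measure_pmf.finite_Lim_measure_incseq) (auto simp: incseq_def)
  also have "(\<Union>b. {s. idle_count P s = 0 \<and> task_count P s < b}) = {s. \<forall>j\<in>P. s j \<noteq> []}"
    by (auto simp: idle0)
  finally have "(\<lambda>b. \<gamma> * real K * measure_pmf.prob \<pi> {s. idle_count P s = 0 \<and> task_count P s < b})
      \<longlonglongrightarrow> \<gamma> * real K * measure_pmf.prob \<pi> {s. \<forall>j\<in>P. s j \<noteq> []}"
    by (intro tendsto_mult_left)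
  then show ?thesis
    using bound unfolding \<Lambda>_def by (intro LIMSEQ_le_const2) auto
qed


section \<open>Riemann sums along equidistributed sequences\<close>

text \<open>Riemann integrability gives a constant mesh width \<open>d\<close>; cells shorter than
  \<open>d\<close> are fine for every choice of tags. Henstock's lemma carries the error bound from
  divisions of \<open>cbox a b\<close> over to the part covering \<open>{\<alpha>..\<beta>}\<close>.
  Since \<open>L\<close> is fixed before the tags, they may later depend on
  \<open>N\<close>.\<close>

lemma Riemann_integrable_on_tag_sums:
  fixes lam :: "real \<Rightarrow> real"
  assumes R: "Riemann_integrable_on lam {0..<1}"
    and \<alpha>\<beta>: "0 \<le> \<alpha>" "\<alpha> < \<beta>" "\<beta> \<le> 1" and e: "0 < e"
  obtains L :: nat where "0 < L"
    and "\<And>x. (\<And>l. l < L \<Longrightarrow> x l \<in> {\<alpha> + real l * ((\<beta> - \<alpha>) / L)..<\<alpha> + real (Suc l) * ((\<beta> - \<alpha>) / L)}) \<Longrightarrow>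
      \<bar>(\<Sum>l<L. (\<beta> - \<alpha>) / L * lam (x l)) - integral {\<alpha>..<\<beta>} lam\<bar> \<le> e"
proof -
  define F where "F x = (if x \<in> {0..<1} then lam x else 0)" for x
  from R obtain a b I where ab: "{0..<1} \<subseteq> cbox a b" and
    I: "\<And>e. e > 0 \<Longrightarrow> \<exists>d>0. \<forall>D. D tagged_division_of cbox a b \<and> (\<lambda>x. ball x d) fine D \<longrightarrow>
          \<bar>(\<Sum>(x, K)\<in>D. measure lborel K * F x) - I\<bar> < e"
    unfolding Riemann_integrable_on_def F_def by blast
  \<comment> \<open>A constant gauge is a gauge, so Henstock-Kurzweil theory applies with the same
    \<open>I\<close>.\<close>
  have "(F has_integral I) (cbox a b)"
    unfolding has_integral
  proof (intro allI impI)
    fix e :: real assume "e > 0"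
    from I[OF this] obtain d where "d > 0" and "\<forall>D. D tagged_division_of cbox a b \<and> (\<lambda>x. ball x d) fine D \<longrightarrow>
          \<bar>(\<Sum>(x, K)\<in>D. measure lborel K * F x) - I\<bar> < e" by blast
    then show "\<exists>\<gamma>. gauge \<gamma> \<and> (\<forall>\<D>. \<D> tagged_division_of cbox a b \<and> \<gamma> fine \<D> \<longrightarrow>
        norm ((\<Sum>(x, k)\<in>\<D>. measure lborel k *\<^sub>R F x) - I) < e)"
      by (intro exI[of _ "\<lambda>x. ball x d"]) (auto simp: gauge_ball)
  qed
  then have int: "F integrable_on cbox a b" and I_eq: "I = integral (cbox a b) F"
    by (auto simp: has_integral_integrable integral_unique)
  obtain d where d: "d > 0" and less_e: "\<And>D. D tagged_division_of cbox a b \<Longrightarrow> (\<lambda>x. ball x d) fine D \<Longrightarrow>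
          norm ((\<Sum>(x, K)\<in>D. measure lborel K *\<^sub>R F x) - integral (cbox a b) F) < e"
    using I[OF e] unfolding I_eq by force
  \<comment> \<open>The closed last cell contains 1 when \<open>\<beta> = 1\<close>, so the box must
    contain the closed unit interval.\<close>
  have "{0..1} = closure {0..<1::real}"
    by simp
  also have "\<dots> \<subseteq> cbox a b"
    using ab closed_cbox closure_minimal by blast
  finally have sub: "{0..1} \<subseteq> cbox a b" .
  obtain L :: nat where L: "(\<beta> - \<alpha>) / d < real L"
    using reals_Archimedean2 by blast
  have L0: "0 < L"
    using L \<alpha>\<beta> d by (intro gr0I) (auto simp: field_simps)
  define \<delta> where "\<delta> = (\<beta> - \<alpha>) / L"
  have \<delta>: "0 < \<delta>" "\<delta> < d" "\<delta> * L = \<beta> - \<alpha>"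
    using L L0 \<alpha>\<beta> d by (auto simp: \<delta>_def field_simps)
  define K where "K l = {\<alpha> + real l * \<delta>..\<alpha> + real (Suc l) * \<delta>}" for l
  have K_sub: "K l \<subseteq> {\<alpha>..\<beta>}" if "l < L" for l
  proof -
    have "real (Suc l) * \<delta> \<le> real L * \<delta>" using that \<delta> by (intro mult_right_mono) auto
    moreover have "0 \<le> real l * \<delta>" using \<delta> by simp
    ultimately show ?thesis using \<delta> by (auto simp: K_def mult.commute)
  qed
  have integral_K: "(\<Sum>l<n. integral (K l) F) = integral {\<alpha>..\<alpha> + real n * \<delta>} F" if "n \<le> L" for n
    using that
  proof (induction n)
    case (Suc n)
    have "{\<alpha>..\<alpha> + real (Suc n) * \<delta>} \<subseteq> {\<alpha>..\<beta>}"
      using K_sub[of n] Suc.prems \<delta> by (auto simp: K_def)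
    then have "F integrable_on {\<alpha>..\<alpha> + real (Suc n) * \<delta>}"
      using \<alpha>\<beta> sub by (intro integrable_on_subinterval[OF int]) auto
    then have "integral {\<alpha>..\<alpha> + real n * \<delta>} F + integral {\<alpha> + real n * \<delta>..\<alpha> + real (Suc n) * \<delta>} F =
        integral {\<alpha>..\<alpha> + real (Suc n) * \<delta>} F"
      using \<delta> by (intro Henstock_Kurzweil_Integration.integral_combine) (auto simp: algebra_simps)
    then show ?case using Suc by (simp add: K_def)
  qed simp
  have "integral {\<alpha>..\<beta>} F = integral {\<alpha>..<\<beta>} F"
    by (rule integral_subset_negligible[symmetric])
       (auto intro: negligible_subset[of "{\<beta>}"])
  also have "\<dots> = integral {\<alpha>..<\<beta>} lam"
    using \<alpha>\<beta> by (intro Henstock_Kurzweil_Integration.integral_cong) (auto simp: F_def)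
  finally have integral_eq: "integral {\<alpha>..\<beta>} F = integral {\<alpha>..<\<beta>} lam" .
  show thesis
  proof (rule that[OF L0])
    fix x assume "\<And>l. l < L \<Longrightarrow> x l \<in> {\<alpha> + real l * ((\<beta> - \<alpha>) / L)..<\<alpha> + real (Suc l) * ((\<beta> - \<alpha>) / L)}"
    then have x: "x l \<in> {\<alpha> + real l * \<delta>..<\<alpha> + real (Suc l) * \<delta>}" if "l < L" for l
      using that by (simp add: \<delta>_def)
    have x01: "x l \<in> {0..<1}" if "l < L" for l
    proof -
      have "{\<alpha> + real l * \<delta>, \<alpha> + real (Suc l) * \<delta>} \<subseteq> {\<alpha>..\<beta>}"
        using K_sub[OF that] \<delta> by (auto simp: K_def algebra_simps)
      then show ?thesis using x[OF that] \<alpha>\<beta> by auto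
    qed
    define D where "D = (\<lambda>l. (x l, K l)) ` {..<L}"
    have inj: "inj_on (\<lambda>l. (x l, K l)) {..<L}"
      using \<delta> by (auto simp: inj_on_def K_def)
    have part: "D tagged_partial_division_of cbox a b"
      unfolding tagged_partial_division_of_def
    proof (intro conjI allI impI)
      show "finite D" by (simp add: D_def)
      fix y k assume "(y, k) \<in> D"
      then obtain l where l: "l < L" "y = x l" "k = K l" by (auto simp: D_def)
      show "y \<in> k" using x[OF l(1)] by (auto simp: l K_def)
      show "k \<subseteq> cbox a b" using K_sub[OF l(1)] sub \<alpha>\<beta> unfolding l by force
      show "\<exists>a b. k = cbox a b" by (auto simp: l K_def)
    next
      fix y1 k1 y2 k2 assume *: "(y1, k1) \<in> D \<and> (y2, k2) \<in> D \<and> (y1, k1) \<noteq> (y2, k2)"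
      then obtain l1 l2 where l: "k1 = K l1" "k2 = K l2" "l1 \<noteq> l2" by (auto simp: D_def)
      have disj: "interior (K l1) \<inter> interior (K l2) = {}" if "l1 < l2" for l1 l2
      proof -
        have "real (Suc l1) * \<delta> \<le> real l2 * \<delta>" using that \<delta> by (intro mult_right_mono) auto
        then show ?thesis by (auto simp: K_def)
      qed
      show "interior k1 \<inter> interior k2 = {}"
        using disj[of l1 l2] disj[of l2 l1] l by (cases l1 l2 rule: linorder_cases) auto
    qed
    have fine: "(\<lambda>x. ball x d) fine D"
    proof (rule fineI)
      fix y k assume "(y, k) \<in> D"
      then obtain l where l: "l < L" "y = x l" "k = K l" by (auto simp: D_def)
      show "k \<subseteq> ball y d"
        using x[OF l(1)] \<delta> unfolding l by (auto simp: K_def dist_real_def algebra_simps)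
    qed
    have "norm (\<Sum>(y, k)\<in>D. measure lborel k *\<^sub>R F y - integral k F) \<le> e"
      by (rule Henstock_lemma_part1[OF int e gauge_ball[OF d] _ part fine]) (rule less_e)
    also have "(\<Sum>(y, k)\<in>D. measure lborel k *\<^sub>R F y - integral k F) = (\<Sum>l<L. \<delta> * lam (x l) - integral (K l) F)"
      unfolding D_def using inj \<delta> x01
      by (subst sum.reindex) (auto simp: K_def F_def algebra_simps intro!: sum.cong)
    also have "\<dots> = (\<Sum>l<L. \<delta> * lam (x l)) - integral {\<alpha>..<\<beta>} lam"
      using integral_K[of L] \<delta> by (simp add: sum_subtractf mult.commute integral_eq)
    finally show "\<bar>(\<Sum>l<L. (\<beta> - \<alpha>) / L * lam (x l)) - integral {\<alpha>..<\<beta>} lam\<bar> \<le> e"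
      by (simp add: \<delta>_def)
  qed
qed

text \<open>The average over the points of a cell lies between the values of \<open>lam\<close> at two of these points,
  and both are admissible tags; so Riemann sums bound the averages without further estimates.\<close>

lemma Riemann_integrable_on_average_tendsto:
  fixes lam :: "real \<Rightarrow> real" and W :: "nat \<Rightarrow> nat" and \<phi> :: "nat \<Rightarrow> real"
  assumes R: "Riemann_integrable_on lam {0..<1}"
    and nonneg: "\<And>x. x \<in> {0..<1} \<Longrightarrow> 0 \<le> lam x"
    and \<phi>: "\<And>i. \<phi> i \<in> {0..<1}"
    and equi: "\<And>x y. 0 \<le> x \<Longrightarrow> x < y \<Longrightarrow> y \<le> 1 \<Longrightarrow>
      (\<lambda>N. real (card {i \<in> {1..W N}. \<phi> i \<in> {x..<y}}) / real (W N)) \<longlonglongrightarrow> y - x"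
    and \<alpha>\<beta>: "0 \<le> \<alpha>" "\<alpha> < \<beta>" "\<beta> \<le> 1"
  shows "(\<lambda>N. (\<Sum>i\<in>{i \<in> {1..W N}. \<phi> i \<in> {\<alpha>..<\<beta>}}. lam (\<phi> i)) / real (W N)) \<longlonglongrightarrow>
    integral {\<alpha>..<\<beta>} lam"
proof -
  define J where "J = integral {\<alpha>..<\<beta>} lam"
  define A where "A N = (\<Sum>i\<in>{i \<in> {1..W N}. \<phi> i \<in> {\<alpha>..<\<beta>}}. lam (\<phi> i)) / real (W N)" for N
  have approx: "\<forall>\<^sub>F N in sequentially. \<bar>A N - J\<bar> \<le> e * (\<bar>J\<bar> + 2)" if e: "0 < e" "e < 1" for e
  proof -
    obtain L :: nat where L: "0 < L" and
      tags: "\<And>x. (\<And>l. l < L \<Longrightarrow> x l \<in> {\<alpha> + real l * ((\<beta> - \<alpha>) / L)..<\<alpha> + real (Suc l) * ((\<beta> - \<alpha>) / L)}) \<Longrightarrow>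
        \<bar>(\<Sum>l<L. (\<beta> - \<alpha>) / L * lam (x l)) - J\<bar> \<le> e"
      using Riemann_integrable_on_tag_sums[OF R \<alpha>\<beta> e(1)] unfolding J_def by blast
    define \<delta> where "\<delta> = (\<beta> - \<alpha>) / L"
    have \<delta>: "0 < \<delta>" "\<delta> * L = \<beta> - \<alpha>"
      using L \<alpha>\<beta> by (auto simp: \<delta>_def)
    define K where "K l = {\<alpha> + real l * \<delta>..<\<alpha> + real (Suc l) * \<delta>}" for l
    define I where "I l N = {i \<in> {1..W N}. \<phi> i \<in> K l}" for l N
    have tags': "\<bar>(\<Sum>l<L. \<delta> * lam (x l)) - J\<bar> \<le> e" if "\<And>l. l < L \<Longrightarrow> x l \<in> K l" for x
      using tags[of x] that by (simp add: K_def \<delta>_def)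
    have ends: "\<alpha> + real (Suc l) * \<delta> \<le> \<beta>" if "l < L" for l
    proof -
      have "real (Suc l) * \<delta> \<le> real L * \<delta>" using that \<delta> by (intro mult_right_mono) auto
      then show ?thesis using \<delta> by (simp add: mult.commute)
    qed
    \<comment> \<open>On the finitely many cells the share of points is eventually within factors
      \<open>1 - e\<close> and \<open>1 + e\<close> of the length \<open>\<delta>\<close>; such a
      relative error factors out of the Riemann sums.\<close>
    have "\<forall>\<^sub>F N in sequentially. \<forall>l\<in>{..<L}.
        (1 - e) * \<delta> < real (card (I l N)) / real (W N) \<and> real (card (I l N)) / real (W N) < (1 + e) * \<delta>"
    proof (intro eventually_ball_finite ballI finite_lessThan)
      fix l assume "l \<in> {..<L}"
      then have "(\<lambda>N. real (card (I l N)) / real (W N)) \<longlonglongrightarrow> (\<alpha> + real (Suc l) * \<delta>) - (\<alpha> + real l * \<delta>)"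
        unfolding I_def K_def using \<delta> \<alpha>\<beta> ends[of l]
        by (intro equi) (auto simp: algebra_simps)
      moreover have "(\<alpha> + real (Suc l) * \<delta>) - (\<alpha> + real l * \<delta>) = \<delta>"
        by (simp add: algebra_simps)
      ultimately have lim: "(\<lambda>N. real (card (I l N)) / real (W N)) \<longlonglongrightarrow> \<delta>"
        by simp
      have "(1 - e) * \<delta> < \<delta>" "\<delta> < (1 + e) * \<delta>" using \<delta> e by (auto simp: algebra_simps)
      with lim show "\<forall>\<^sub>F N in sequentially. (1 - e) * \<delta> < real (card (I l N)) / real (W N) \<and>
          real (card (I l N)) / real (W N) < (1 + e) * \<delta>"
        by (auto intro: eventually_conj order_tendstoD)
    qed
    then show ?thesis
    proof (rule eventually_mono)
      fix N
      assume N: "\<forall>l\<in>{..<L}. (1 - e) * \<delta> < real (card (I l N)) / real (W N) \<and>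
        real (card (I l N)) / real (W N) < (1 + e) * \<delta>"
      have finI: "finite (I l N)" for l by (simp add: I_def)
      \<comment> \<open>A positive share forces a point into each cell, so that the extremal points
        below exist.\<close>
      have neI: "I l N \<noteq> {}" if "l < L" for l
      proof
        assume "I l N = {}"
        moreover have "(1 - e) * \<delta> < real (card (I l N)) / real (W N)" using N that by simp
        moreover have "0 < (1 - e) * \<delta>" using e \<delta> by simp
        ultimately show False by simp
      qed
      have ex_max: "\<exists>i\<in>S. \<forall>i'\<in>S. g i' \<le> g i" if "finite S" "S \<noteq> {}" for S and g :: "nat \<Rightarrow> real"
      proof -
        have "Max (g ` S) \<in> g ` S" using that by (intro Max_in) auto
        then obtain i where "i \<in> S" "Max (g ` S) = g i" by blast
        then show ?thesis using that by (metis Max_ge finite_imageI imageI)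
      qed
      \<comment> \<open>\<open>u l\<close>, and \<open>v l\<close> below, index points where
        \<open>lam\<close> is largest and smallest in the cell. They depend on \<open>N\<close>,
        which the uniformity in the tags permits.\<close>
      have "\<exists>i. i \<in> I l N \<and> (\<forall>i'\<in>I l N. lam (\<phi> i') \<le> lam (\<phi> i))" if "l < L" for l
        using ex_max[OF finI neI[OF that], of "\<lambda>i. lam (\<phi> i)"] by blast
      then obtain u where u: "\<And>l. l < L \<Longrightarrow> u l \<in> I l N"
        "\<And>l i. l < L \<Longrightarrow> i \<in> I l N \<Longrightarrow> lam (\<phi> i) \<le> lam (\<phi> (u l))"
        by metis
      have "\<exists>i. i \<in> I l N \<and> (\<forall>i'\<in>I l N. lam (\<phi> i) \<le> lam (\<phi> i'))" if "l < L" for l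
        using ex_max[OF finI neI[OF that], of "\<lambda>i. - lam (\<phi> i)"] by auto
      then obtain v where v: "\<And>l. l < L \<Longrightarrow> v l \<in> I l N"
        "\<And>l i. l < L \<Longrightarrow> i \<in> I l N \<Longrightarrow> lam (\<phi> (v l)) \<le> lam (\<phi> i)"
        by metis
      have in_cell: "\<exists>l<L. x \<in> K l" if "x \<in> {\<alpha>..<\<beta>}" for x
      proof -
        define l where "l = nat \<lfloor>(x - \<alpha>) / \<delta>\<rfloor>"
        have "0 \<le> (x - \<alpha>) / \<delta>" using that \<delta> by auto
        then have l: "real l \<le> (x - \<alpha>) / \<delta>" "(x - \<alpha>) / \<delta> < real (Suc l)"
          unfolding l_def by (auto simp: of_nat_nat) linarith+
        have "(x - \<alpha>) / \<delta> < real L" using that \<delta> by (auto simp: field_simps)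
        with l have "l < L" by linarith
        moreover have "x \<in> K l" using l \<delta> by (auto simp: K_def field_simps)
        ultimately show ?thesis by blast
      qed
      have K_sub: "K l \<subseteq> {\<alpha>..<\<beta>}" if "l < L" for l
      proof -
        have "0 \<le> real l * \<delta>" using \<delta> by simp
        then show ?thesis using ends[OF that] by (auto simp: K_def)
      qed
      have disj: "K l \<inter> K l' = {}" if "l \<noteq> l'" for l l'
      proof -
        have "K l \<inter> K l' = {}" if "l < l'" for l l'
        proof -
          have "real (Suc l) * \<delta> \<le> real l' * \<delta>" using that \<delta> by (intro mult_right_mono) auto
          then show ?thesis by (auto simp: K_def)
        qed
        from this[of l l'] this[of l' l] that show ?thesis
          by (cases l l' rule: linorder_cases) auto
      qed
      have "{i \<in> {1..W N}. \<phi> i \<in> {\<alpha>..<\<beta>}} = (\<Union>l<L. I l N)"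
        using in_cell K_sub by (force simp: I_def)
      then have "A N = (\<Sum>i\<in>(\<Union>l<L. I l N). lam (\<phi> i)) / real (W N)"
        unfolding A_def by (rule arg_cong)
      also have "(\<Sum>i\<in>(\<Union>l<L. I l N). lam (\<phi> i)) = (\<Sum>l<L. \<Sum>i\<in>I l N. lam (\<phi> i))"
        using disj finI by (intro sum.UNION_disjoint) (auto simp: I_def)
      finally have A: "A N = (\<Sum>l<L. (\<Sum>i\<in>I l N. lam (\<phi> i)) / real (W N))"
        by (simp add: sum_divide_distrib)
      have "A N \<le> (\<Sum>l<L. real (card (I l N)) / real (W N) * lam (\<phi> (u l)))"
        unfolding A
      proof (rule sum_mono)
        fix l assume "l \<in> {..<L}"
        then have "(\<Sum>i\<in>I l N. lam (\<phi> i)) \<le> real (card (I l N)) * lam (\<phi> (u l))"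
          using u by (intro sum_bounded_above) auto
        then show "(\<Sum>i\<in>I l N. lam (\<phi> i)) / real (W N) \<le> real (card (I l N)) / real (W N) * lam (\<phi> (u l))"
          by (simp add: divide_right_mono)
      qed
      also have "\<dots> \<le> (\<Sum>l<L. (1 + e) * \<delta> * lam (\<phi> (u l)))"
        using N nonneg \<phi> by (intro sum_mono mult_right_mono) (auto intro: less_imp_le)
      also have "\<dots> = (1 + e) * (\<Sum>l<L. \<delta> * lam (\<phi> (u l)))"
        by (simp add: sum_distrib_left mult.assoc)
      also have "\<dots> \<le> (1 + e) * (J + e)"
        using tags'[of "\<lambda>l. \<phi> (u l)"] u(1) e by (intro mult_left_mono) (auto simp: I_def)
      finally have upper: "A N \<le> (1 + e) * (J + e)" .
      have "(1 - e) * (J - e) \<le> (1 - e) * (\<Sum>l<L. \<delta> * lam (\<phi> (v l)))"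
        using tags'[of "\<lambda>l. \<phi> (v l)"] v(1) e by (intro mult_left_mono) (auto simp: I_def)
      also have "\<dots> = (\<Sum>l<L. (1 - e) * \<delta> * lam (\<phi> (v l)))"
        by (simp add: sum_distrib_left mult.assoc)
      also have "\<dots> \<le> (\<Sum>l<L. real (card (I l N)) / real (W N) * lam (\<phi> (v l)))"
        using N nonneg \<phi> by (intro sum_mono mult_right_mono) (auto intro: less_imp_le)
      also have "\<dots> \<le> A N"
        unfolding A
      proof (rule sum_mono)
        fix l assume "l \<in> {..<L}"
        then have "real (card (I l N)) * lam (\<phi> (v l)) \<le> (\<Sum>i\<in>I l N. lam (\<phi> i))"
          using v by (intro sum_bounded_below) auto
        then show "real (card (I l N)) / real (W N) * lam (\<phi> (v l)) \<le> (\<Sum>i\<in>I l N. lam (\<phi> i)) / real (W N)"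
          by (simp add: divide_right_mono)
      qed
      finally have lower: "(1 - e) * (J - e) \<le> A N" .
      \<comment> \<open>Expanding the two bounds leaves errors \<open>e * J\<close>,
        \<open>e\<close> and \<open>e * e\<close>; with \<open>e < 1\<close> they total at most
        \<open>e * \<bar>J\<bar> + 2 * e\<close>.\<close>
      have "A N \<le> J + e + e * J + e * e" "J - e - e * J + e * e \<le> A N"
        using upper lower by (simp_all add: algebra_simps)
      moreover have "e * e \<le> e" "0 \<le> e * e"
        using e by (simp_all add: mult_left_le)
      moreover have "\<bar>e * J\<bar> = e * \<bar>J\<bar>"
        using e by (simp add: abs_mult)
      ultimately have "\<bar>A N - J\<bar> \<le> e * \<bar>J\<bar> + 2 * e"
        using e by linarith
      then show "\<bar>A N - J\<bar> \<le> e * (\<bar>J\<bar> + 2)"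
        by (simp add: algebra_simps)
    qed
  qed
  have "A \<longlonglongrightarrow> J"
  proof (rule tendstoI)
    fix r :: real assume r: "0 < r"
    define e where "e = min (1 / 2) (r / (2 * (\<bar>J\<bar> + 2)))"
    have e: "0 < e" "e < 1" "e \<le> r / (2 * (\<bar>J\<bar> + 2))"
      using r by (auto simp: e_def)
    from e(3) have "e * (\<bar>J\<bar> + 2) \<le> r / 2"
      by (simp add: field_simps)
    then have "e * (\<bar>J\<bar> + 2) < r"
      using r by simp
    then show "\<forall>\<^sub>F N in sequentially. dist (A N) J < r"
      using approx[OF e(1,2)] by (elim eventually_mono) (simp add: dist_real_def)
  qed
  then show ?thesis by (simp only: A_def[abs_def] J_def)
qed


section \<open>The ICRD sub-systems\<close>

lemma unit_partition_mono:
  assumes "unit_partition H w" "a \<le> b" "b \<le> H"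
  shows "w a \<le> w b"
  using assms(2,3)
proof (induction b rule: dec_induct)
  case (step n)
  then have "w n < w (Suc n)" using assms(1) by (auto simp: unit_partition_def)
  with step show ?case by simp
qed simp

lemma unit_partition_cell:
  assumes "unit_partition H w" "h \<in> {1..H}"
  shows "0 \<le> w (h - 1)" "w (h - 1) < w h" "w h \<le> 1"
proof -
  show "0 \<le> w (h - 1)" "w h \<le> 1"
    using unit_partition_mono[OF assms(1), of 0 "h - 1"] unit_partition_mono[OF assms(1), of h H] assms
    by (auto simp: unit_partition_def)
  have "\<forall>k<H. w k < w (Suc k)" "h - 1 < H"
    using assms by (auto simp: unit_partition_def)
  then have "w (h - 1) < w (Suc (h - 1))" by blast
  then show "w (h - 1) < w h" using assms(2) by simp
qed

lemma unit_partition_cell_unique: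
  assumes "unit_partition H w" "h \<in> {1..H}" "h' \<in> {1..H}" "x \<in> cell w h" "x \<in> cell w h'"
  shows "h = h'"
proof -
  have "\<not> h < h'" if "h \<in> {1..H}" "h' \<in> {1..H}" "x \<in> cell w h" "x \<in> cell w h'" for h h'
    using unit_partition_mono[OF assms(1), of h "h' - 1"] that by force
  then show ?thesis using assms by (meson linorder_neqE_nat)
qed

lemma unit_partition_cover:
  assumes "unit_partition H w" "x \<in> {0..<1}"
  shows "\<exists>h\<in>{1..H}. x \<in> cell w h"
proof -
  \<comment> \<open>The least index with \<open>x < w h\<close> is not 0 because
    \<open>w 0 = 0\<close>; minimality gives the left end of the cell.\<close>
  define h where "h = (LEAST h. x < w h)"
  have ex: "x < w H" using assms by (auto simp: unit_partition_def)
  have h: "x < w h" "h \<le> H"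
    unfolding h_def using ex by (auto intro: LeastI Least_le)
  have "h \<noteq> 0"
    using h assms by (intro notI) (auto simp: unit_partition_def)
  moreover from this have "\<not> x < w (h - 1)"
    unfolding h_def by (intro not_less_Least) auto
  ultimately show ?thesis using h by (intro bexI[of _ h]) auto
qed

section \<open>Dispatcher classes, their pools and limiting arrival rates\<close>

definition dispatcher_class :: "(nat \<Rightarrow> nat) \<Rightarrow> (nat \<Rightarrow> real) \<Rightarrow> (nat \<Rightarrow> real) \<Rightarrow> nat \<Rightarrow> nat \<Rightarrow> nat set" where
  "dispatcher_class W \<phi>1 w N h = {i \<in> {1..W N}. \<phi>1 i \<in> cell w h}"

definition class_arrival ::
  "(nat \<Rightarrow> nat) \<Rightarrow> (nat \<Rightarrow> real) \<Rightarrow> (real \<Rightarrow> real) \<Rightarrow> (nat \<Rightarrow> real) \<Rightarrow> nat \<Rightarrow> nat \<Rightarrow> real" where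
  "class_arrival W \<phi>1 lam w N h = (\<Sum>i\<in>dispatcher_class W \<phi>1 w N h. lam (\<phi>1 i))"

definition class_pool :: "nat \<Rightarrow> (nat \<Rightarrow> nat \<Rightarrow> nat set) \<Rightarrow> nat \<Rightarrow> nat set" where
  "class_pool M V h = (\<Union>m\<in>{1..M}. V h m)"

lemma ICRD_pool_eq:
  assumes "unit_partition H w" "h \<in> {1..H}" "\<phi>1 i \<in> cell w h"
  shows "ICRD_pool H M w \<phi>1 V i = class_pool M V h"
proof -
  have "{h \<in> {1..H}. \<phi>1 i \<in> cell w h} = {h}"
    using assms unit_partition_cell_unique[OF assms(1)] by blast
  then show ?thesis by (simp add: ICRD_pool_def class_pool_def)
qed

text \<open>Assumption (d) converts averages over the \<open>W N\<close> dispatchers into rates per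
  server; this is the source of the factor \<open>\<xi>\<close>.\<close>

lemma arrival_average_tendsto:
  assumes f: "f_sequence W \<phi>1 \<phi>2 f" and a: "assumption_a lam"
    and c: "assumption_c W \<phi>1 \<phi>2" and d: "assumption_d W \<xi>"
    and \<alpha>\<beta>: "0 \<le> \<alpha>" "\<alpha> < \<beta>" "\<beta> \<le> 1"
  shows "(\<lambda>N. (\<Sum>i\<in>{i \<in> {1..W N}. \<phi>1 i \<in> {\<alpha>..<\<beta>}}. lam (\<phi>1 i)) / real N) \<longlonglongrightarrow>
    \<xi> * integral {\<alpha>..<\<beta>} lam"
proof -
  let ?S = "\<lambda>N. \<Sum>i\<in>{i \<in> {1..W N}. \<phi>1 i \<in> {\<alpha>..<\<beta>}}. lam (\<phi>1 i)"
  have "(\<lambda>N. ?S N / real (W N)) \<longlonglongrightarrow> integral {\<alpha>..<\<beta>} lam"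
  proof (rule Riemann_integrable_on_average_tendsto)
    fix x y :: real assume xy: "0 \<le> x" "x < y" "y \<le> 1"
    have "is_interval {x..<y}" "{x..<y} \<subseteq> {0..<1}"
      using xy by (auto simp: is_interval_co)
    then have "(\<lambda>N. (\<Sum>i\<in>{1..W N}. indicat_real {x..<y} (\<phi>1 i)) / real (W N)) \<longlonglongrightarrow> measure lebesgue {x..<y}"
      using c unfolding assumption_c_def by blast
    moreover have "measure lebesgue {x..<y} = y - x"
      using xy by simp
    moreover have "(\<Sum>i\<in>{1..W N}. indicat_real {x..<y} (\<phi>1 i)) = real (card {i \<in> {1..W N}. \<phi>1 i \<in> {x..<y}})" for N
      by (simp add: indicator_def Int_def)
    ultimately show "(\<lambda>N. real (card {i \<in> {1..W N}. \<phi>1 i \<in> {x..<y}}) / real (W N)) \<longlonglongrightarrow> y - x"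
      by simp
  qed (use a f \<alpha>\<beta> in \<open>auto simp: assumption_a_def f_sequence_def\<close>)
  then have "(\<lambda>N. real (W N) / real N * (?S N / real (W N))) \<longlonglongrightarrow> \<xi> * integral {\<alpha>..<\<beta>} lam"
    using d unfolding assumption_d_def by (intro tendsto_mult) auto
  \<comment> \<open>If \<open>W N = 0\<close>, the sum of arrival rates is empty and both sides are
    0.\<close>
  also have "(\<lambda>N. real (W N) / real N * (?S N / real (W N))) = (\<lambda>N. ?S N / real N)"
  proof
    fix N show "real (W N) / real N * (?S N / real (W N)) = ?S N / real N"
      by (cases "W N = 0") auto
  qed
  finally show ?thesis .
qed

lemma class_arrival_tendsto:
  assumes "f_sequence W \<phi>1 \<phi>2 f" "assumption_a lam" "assumption_c W \<phi>1 \<phi>2" "assumption_d W \<xi>"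
    and "unit_partition H w" "h \<in> {1..H}"
  shows "(\<lambda>N. class_arrival W \<phi>1 lam w N h / real N) \<longlonglongrightarrow> class_rate \<xi> lam w h"
  using arrival_average_tendsto[OF assms(1-4), of "w (h - 1)" "w h"] unit_partition_cell[OF assms(5,6)]
  by (simp add: class_arrival_def dispatcher_class_def class_rate_def)

lemma total_arrival_tendsto:
  assumes "f_sequence W \<phi>1 \<phi>2 f" "assumption_a lam" "assumption_c W \<phi>1 \<phi>2" "assumption_d W \<xi>"
  shows "(\<lambda>N. (\<Sum>i\<in>{1..W N}. lam (\<phi>1 i)) / real N) \<longlonglongrightarrow> \<xi> * integral {0..<1} lam"
proof -
  have "{i \<in> {1..W N}. \<phi>1 i \<in> {0..<1}} = {1..W N}" for N
    using assms(1) by (auto simp: f_sequence_def)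
  then show ?thesis
    using arrival_average_tendsto[OF assms, of 0 1] by simp
qed

section \<open>Bounds for minimal service rates and class rates\<close>

lemma min_service_le:
  assumes f: "f_sequence W \<phi>1 \<phi>2 f" and "unit_partition H w" "unit_partition M v"
    and "h \<in> {1..H}" "m \<in> {1..M}" "x \<in> cell w h" "y \<in> cell v m"
  shows "min_service f w v h m \<le> f x y"
proof -
  have "0 \<le> f x y" if "x \<in> cell w h" "y \<in> cell v m" for x y
    using f unit_partition_cell[OF assms(2,4)] unit_partition_cell[OF assms(3,5)] that
    unfolding f_sequence_def by force
  then have "bdd_below ((\<lambda>(x, y). f x y) ` (cell w h \<times> cell v m))"
    by (intro bdd_belowI[of _ 0]) auto
  then show ?thesis
    unfolding min_service_def using cINF_lower[of "\<lambda>(x, y). f x y" "cell w h \<times> cell v m" "(x, y)"] assms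
    by auto
qed

lemma min_service_nonneg:
  assumes f: "f_sequence W \<phi>1 \<phi>2 f" and "unit_partition H w" "unit_partition M v"
    and "h \<in> {1..H}" "m \<in> {1..M}"
  shows "0 \<le> min_service f w v h m"
proof -
  have "cell w h \<times> cell v m \<noteq> {}"
    using unit_partition_cell[OF assms(2,4)] unit_partition_cell[OF assms(3,5)] by auto
  moreover have "0 \<le> f x y" if "x \<in> cell w h" "y \<in> cell v m" for x y
    using f unit_partition_cell[OF assms(2,4)] unit_partition_cell[OF assms(3,5)] that
    unfolding f_sequence_def by force
  ultimately show ?thesis
    unfolding min_service_def by (intro cINF_greatest) auto
qed

lemma class_rate_nonneg:
  assumes a: "assumption_a lam" and d: "assumption_d W \<xi>" and w: "unit_partition H w" "h \<in> {1..H}"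
  shows "0 \<le> class_rate \<xi> lam w h"
proof -
  \<comment> \<open>Should \<open>lam\<close> fail to be integrable over the cell,
    \<open>integral\<close> takes the default value 0.\<close>
  have "0 \<le> integral (cell w h) lam"
    using a unit_partition_cell[OF w]
    by (cases "lam integrable_on cell w h")
       (auto intro!: integral_nonneg simp: assumption_a_def not_integrable_integral)
  then show ?thesis using d by (simp add: class_rate_def assumption_d_def)
qed

text \<open>A zero minimum under positive load makes the \<open>ereal\<close> quotient infinite; the
  other terms are nonnegative, so the sum could not be below 1. Hence the real quotients in the pool
  sizes are genuine wherever there is load.\<close>

lemma min_service_pos:
  assumes f: "f_sequence W \<phi>1 \<phi>2 f" and a: "assumption_a lam" and d: "assumption_d W \<xi>"
    and sub: "subcritical H M w v p \<xi> lam f"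
    and hm: "h \<in> {1..H}" "m \<in> {1..M}" and p: "0 < p h m" and rate: "0 < class_rate \<xi> lam w h"
  shows "0 < min_service f w v h m"
proof (rule ccontr)
  assume "\<not> 0 < min_service f w v h m"
  have w: "unit_partition H w" and v: "unit_partition M v"
    and p0: "\<And>h m. h \<in> {1..H} \<Longrightarrow> m \<in> {1..M} \<Longrightarrow> 0 \<le> p h m"
    using sub by (auto simp: subcritical_def)
  let ?q = "\<lambda>h. ereal (p h m * class_rate \<xi> lam w h) / ereal ((v m - v (m - 1)) * min_service f w v h m)"
  have "min_service f w v h m = 0"
    using \<open>\<not> 0 < min_service f w v h m\<close> min_service_nonneg[OF f w v hm] by simp
  then have "?q h = \<infinity>"
    using p rate by (simp add: divide_ereal_def)
  moreover have "0 \<le> ?q k" if "k \<in> {1..H}" for k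
    unfolding divide_ereal_def
    using that p0[OF that hm(2)] class_rate_nonneg[OF a d w that] min_service_nonneg[OF f w v that hm(2)]
      unit_partition_cell(2)[OF v hm(2)]
    by (intro ereal_0_le_mult) (auto simp: ereal_inverse_nonneg_iff)
  then have "?q h \<le> (\<Sum>h\<in>{1..H}. ?q h)"
    using hm sum_mono2[of "{1..H}" "{h}" ?q] by simp
  moreover have "(\<Sum>h\<in>{1..H}. ?q h) < 1"
    using sub hm by (auto simp: subcritical_def)
  ultimately show False by simp
qed

section \<open>Disjointness and capacity of the pools\<close>

lemma ICRD_division_disjoint:
  assumes v: "unit_partition M v" and V: "ICRD_division H M w v p \<xi> lam f \<epsilon> \<phi>2 N V"
    and hm: "h \<in> {0..H}" "m \<in> {1..M}" "h' \<in> {0..H}" "m' \<in> {1..M}"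
    and j: "j \<in> V h m" "j \<in> V h' m'"
  shows "h = h'" "m = m'"
proof -
  have cls: "V h m \<subseteq> server_class \<phi>2 v N m" if "h \<in> {0..H}" "m \<in> {1..M}" for h m
    using V that unfolding ICRD_division_def by blast
  \<comment> \<open>Different \<open>m\<close> are separated by the cells of \<open>v\<close>,
    different \<open>h\<close> by the division itself.\<close>
  have "\<phi>2 j \<in> cell v m" "\<phi>2 j \<in> cell v m'"
    using cls[OF hm(1,2)] cls[OF hm(3,4)] j by (auto simp: server_class_def)
  then show m: "m = m'"
    using unit_partition_cell_unique[OF v] hm by blast
  have "disjoint_family_on (\<lambda>h. V h m) {0..H}"
    using V hm by (auto simp: ICRD_division_def)
  then show "h = h'"
    using j hm m unfolding disjoint_family_on_def by blast
qed

lemma class_pool_disjoint: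
  assumes v: "unit_partition M v" and V: "ICRD_division H M w v p \<xi> lam f \<epsilon> \<phi>2 N V"
    and "h \<in> {1..H}" "h' \<in> {1..H}" "h \<noteq> h'"
  shows "class_pool M V h \<inter> class_pool M V h' = {}"
  using ICRD_division_disjoint(1)[OF v V, of h _ h'] assms(3-5)
  by (fastforce simp: class_pool_def)

lemma class_pool_subset:
  assumes V: "ICRD_division H M w v p \<xi> lam f \<epsilon> \<phi>2 N V" and "h \<in> {1..H}"
  shows "class_pool M V h \<subseteq> {1..N}"
proof
  fix j assume "j \<in> class_pool M V h"
  then obtain m where m: "m \<in> {1..M}" "j \<in> V h m" by (auto simp: class_pool_def)
  then have "j \<in> server_class \<phi>2 v N m"
    using V assms(2) unfolding ICRD_division_def by fastforce
  then show "j \<in> {1..N}" by (simp add: server_class_def)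
qed

text \<open>Weighted by the minimal rate, the load-based part of \<open>V h m\<close> has capacity
  \<open>class_rate \<xi> lam w h * p h m\<close>; by the unit row sum these add up to the class
  rate, and \<open>\<epsilon>\<close> supplies the surplus. Each \<open>m\<close> loses at most one
  server to the floor and \<open>card Q\<close> to the removal of \<open>Q\<close>. Charging all of
  \<open>Q\<close> to every \<open>m\<close> is crude, but costs only a constant factor.\<close>

lemma class_pool_capacity:
  assumes V: "ICRD_division H M w v p \<xi> lam f \<epsilon> \<phi>2 N V" and h: "h \<in> {1..H}"
    and w: "unit_partition H w" and v: "unit_partition M v" and f: "f_sequence W \<phi>1 \<phi>2 f"
    and pos: "\<And>m. m \<in> {1..M} \<Longrightarrow> min_service f w v h m = 0 \<Longrightarrow> p h m = 0"
    and sum_p: "(\<Sum>m\<in>{1..M}. p h m) = 1"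
    and Q: "finite Q"
  defines "\<mu> \<equiv> \<lambda>j. \<Sum>m\<in>{1..M}. of_bool (j \<in> V h m) * min_service f w v h m"
  shows "real N * (class_rate \<xi> lam w h + (\<Sum>m\<in>{1..M}. min_service f w v h m * \<epsilon> h m)) -
      (1 + real (card Q)) * (\<Sum>m\<in>{1..M}. min_service f w v h m) \<le> (\<Sum>j\<in>class_pool M V h - Q. \<mu> j)"
proof -
  let ?\<mu> = "min_service f w v h" and ?P = "class_pool M V h"
  have finP: "finite ?P"
    using class_pool_subset[OF V h] finite_subset by blast
  have summand: "real N * (class_rate \<xi> lam w h * p h m + ?\<mu> m * \<epsilon> h m) - (1 + real (card Q)) * ?\<mu> m \<le>
      ?\<mu> m * real (card (V h m - Q))" if m: "m \<in> {1..M}" for m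
  proof -
    have \<mu>0: "0 \<le> ?\<mu> m" by (rule min_service_nonneg[OF f w v h m])
    define q where "q = class_rate \<xi> lam w h * p h m / ?\<mu> m"
    \<comment> \<open>If the minimal rate is 0, the right side vanishes and so does the left,
      through \<open>pos\<close>.\<close>
    have q: "class_rate \<xi> lam w h * p h m = ?\<mu> m * q"
      using pos[OF m] by (cases "?\<mu> m = 0") (auto simp: q_def)
    have "int (card (V h m)) = \<lfloor>real N * (q + \<epsilon> h m)\<rfloor>"
      using V h m by (auto simp: ICRD_division_def q_def)
    then have "real N * (q + \<epsilon> h m) - 1 \<le> real (card (V h m))"
      by linarith
    moreover have "card (V h m) - card Q \<le> card (V h m - Q)"
      by (rule diff_card_le_card_Diff[OF Q])
    ultimately have "?\<mu> m * (real N * (q + \<epsilon> h m) - (1 + real (card Q))) \<le>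
        ?\<mu> m * real (card (V h m - Q))"
      using \<mu>0 by (intro mult_left_mono) linarith+
    then show ?thesis unfolding q by (simp add: algebra_simps)
  qed
  have "real N * (class_rate \<xi> lam w h + (\<Sum>m\<in>{1..M}. ?\<mu> m * \<epsilon> h m)) - (1 + real (card Q)) * (\<Sum>m\<in>{1..M}. ?\<mu> m) =
      real N * (class_rate \<xi> lam w h * (\<Sum>m\<in>{1..M}. p h m) + (\<Sum>m\<in>{1..M}. ?\<mu> m * \<epsilon> h m)) -
      (1 + real (card Q)) * (\<Sum>m\<in>{1..M}. ?\<mu> m)"
    by (simp only: sum_p mult_1_right)
  also have "\<dots> = (\<Sum>m\<in>{1..M}. real N * (class_rate \<xi> lam w h * p h m + ?\<mu> m * \<epsilon> h m) - (1 + real (card Q)) * ?\<mu> m)"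
    by (simp only: sum_subtractf sum_distrib_left sum.distrib distrib_left)
  also have "\<dots> \<le> (\<Sum>m\<in>{1..M}. ?\<mu> m * real (card (V h m - Q)))"
    by (intro sum_mono summand)
  also have "\<dots> = (\<Sum>m\<in>{1..M}. \<Sum>j\<in>?P - Q. of_bool (j \<in> V h m) * ?\<mu> m)"
  proof (intro sum.cong refl)
    fix m assume "m \<in> {1..M}"
    then have "{j \<in> ?P - Q. j \<in> V h m} = V h m - Q"
      by (auto simp: class_pool_def)
    moreover have "(\<Sum>j\<in>?P - Q. of_bool (j \<in> V h m) * ?\<mu> m) = ?\<mu> m * real (card {j \<in> ?P - Q. j \<in> V h m})"
      using finP by (simp add: Int_def flip: sum_distrib_right)
    ultimately show "?\<mu> m * real (card (V h m - Q)) = (\<Sum>j\<in>?P - Q. of_bool (j \<in> V h m) * ?\<mu> m)"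
      by simp
  qed
  also have "\<dots> = (\<Sum>j\<in>?P - Q. \<mu> j)"
    unfolding \<mu>_def by (rule sum.swap)
  finally show ?thesis .
qed

section \<open>The event that all servers of one class pool are busy\<close>

abbreviation (input) ICRD_system where
  "ICRD_system W \<phi>1 \<phi>2 lam f N pool \<equiv> restrict_system (f_system W \<phi>1 \<phi>2 lam f N) pool"

lemma ICRD_system_simps [simp]:
  "dispatchers (ICRD_system W \<phi>1 \<phi>2 lam f N pool) = {1..W N}"
  "servers (ICRD_system W \<phi>1 \<phi>2 lam f N pool) = {1..N}"
  "arrival (ICRD_system W \<phi>1 \<phi>2 lam f N pool) = (\<lambda>i. lam (\<phi>1 i))"
  "service (ICRD_system W \<phi>1 \<phi>2 lam f N pool) = (\<lambda>i j. if j \<in> pool i then f (\<phi>1 i) (\<phi>2 j) else 0)"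
  by (simp_all add: restrict_system_def f_system_def cong: if_cong)

text \<open>The single-pool estimate, with \<open>C\<close> the dispatchers of class
  \<open>h\<close>. The cells cover the unit interval, so every other dispatcher lies in another
  class and has a disjoint pool. The minimal rate of the cell of a server bounds its rate for all
  types of the class.\<close>

lemma prob_class_busy_le:
  assumes f: "f_sequence W \<phi>1 \<phi>2 f" and a: "assumption_a lam"
    and w: "unit_partition H w" and v: "unit_partition M v"
    and V: "ICRD_division H M w v p \<xi> lam f \<epsilon> \<phi>2 N V"
    and stat: "steady_state (ICRD_system W \<phi>1 \<phi>2 lam f N pool) pool (JIQ pool) \<pi>"
    and pool: "pool = ICRD_pool H M w \<phi>1 V"
    and h: "h \<in> {1..H}"
    and pos: "\<And>m. m \<in> {1..M} \<Longrightarrow> min_service f w v h m = 0 \<Longrightarrow> p h m = 0"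
    and sum_p: "(\<Sum>m\<in>{1..M}. p h m) = 1"
    and cap: "class_arrival W \<phi>1 lam w N h + \<gamma> \<le>
      real N * (class_rate \<xi> lam w h + (\<Sum>m\<in>{1..M}. min_service f w v h m * \<epsilon> h m)) -
      (1 + real K) * (\<Sum>m\<in>{1..M}. min_service f w v h m)"
    and \<gamma>: "0 \<le> \<gamma>"
  shows "\<gamma> * real K * measure_pmf.prob \<pi> {s. \<forall>j\<in>class_pool M V h. s j \<noteq> []} \<le> class_arrival W \<phi>1 lam w N h"
proof -
  let ?G = "ICRD_system W \<phi>1 \<phi>2 lam f N pool"
  define \<mu> where "\<mu> j = (\<Sum>m\<in>{1..M}. of_bool (j \<in> V h m) * min_service f w v h m)" for j
  define C where "C = dispatcher_class W \<phi>1 w N h"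
  have \<phi>1: "\<phi>1 i \<in> {0..<1}" for i using f by (auto simp: f_sequence_def)
  \<comment> \<open>A server of the pool lies in only one \<open>V h m\<close>, so the sum defining
    \<open>\<mu>\<close> collapses to one term.\<close>
  have \<mu>_eq: "\<mu> j = min_service f w v h m" if "m \<in> {1..M}" "j \<in> V h m" for j m
  proof -
    have "h \<in> {0..H}" using h by simp
    then have "j \<in> V h m' \<longleftrightarrow> m' = m" if "m' \<in> {1..M}" for m'
      using ICRD_division_disjoint(2)[OF v V _ that _ _ _ \<open>j \<in> V h m\<close>] \<open>m \<in> {1..M}\<close> \<open>j \<in> V h m\<close> by metis
    then have "\<mu> j = (\<Sum>m'\<in>{1..M}. if m' = m then min_service f w v h m' else 0)"
      unfolding \<mu>_def by (intro sum.cong) auto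
    then show ?thesis using that by simp
  qed
  have S0: "0 \<le> (\<Sum>m\<in>{1..M}. min_service f w v h m)"
    by (intro sum_nonneg min_service_nonneg[OF f w v h])
  have "\<gamma> * real K * measure_pmf.prob \<pi> {s. \<forall>j\<in>class_pool M V h. s j \<noteq> []} \<le> (\<Sum>i\<in>C. arrival ?G i)"
  proof (rule prob_all_busy_le[OF _ _ stat, where \<mu> = \<mu>])
    show "class_pool M V h \<subseteq> servers ?G"
      using class_pool_subset[OF V h] by simp
    show "C \<subseteq> dispatchers ?G"
      by (auto simp: C_def dispatcher_class_def)
    show poolC: "pool i = class_pool M V h" if "i \<in> C" for i
      unfolding pool using that by (intro ICRD_pool_eq[OF w h]) (simp add: C_def dispatcher_class_def)
    show "pool i \<inter> class_pool M V h = {}" if "i \<in> dispatchers ?G - C" for i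
    proof -
      obtain h' where h': "h' \<in> {1..H}" "\<phi>1 i \<in> cell w h'"
        using unit_partition_cover[OF w \<phi>1] by blast
      then have "h' \<noteq> h" using that by (auto simp: C_def dispatcher_class_def)
      then show ?thesis
        unfolding pool ICRD_pool_eq[of H w h' \<phi>1 i, OF w h'] by (intro class_pool_disjoint[OF v V] h h')
    qed
    show "0 \<le> arrival ?G i" for i
      using a \<phi>1 by (simp add: assumption_a_def)
    show "\<mu> j \<le> service ?G i j" if ij: "i \<in> C" "j \<in> class_pool M V h" for i j
    proof -
      obtain m where m: "m \<in> {1..M}" "j \<in> V h m" using ij by (auto simp: class_pool_def)
      then have "j \<in> server_class \<phi>2 v N m"
        using V h unfolding ICRD_division_def by fastforce
      then have "min_service f w v h m \<le> f (\<phi>1 i) (\<phi>2 j)"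
        using ij by (intro min_service_le[OF f w v h m(1)])
          (auto simp: server_class_def C_def dispatcher_class_def)
      then show ?thesis using \<mu>_eq[OF m] poolC[OF ij(1)] ij by simp
    qed
    show "0 \<le> \<mu> j" for j
      unfolding \<mu>_def by (intro sum_nonneg mult_nonneg_nonneg min_service_nonneg[OF f w v h]) auto
    fix Q assume Q: "Q \<subseteq> class_pool M V h" "card Q < K"
    have "finite Q"
      using Q(1) class_pool_subset[OF V h] by (intro finite_subset[of Q "{1..N}"]) auto
    have "(\<Sum>i\<in>C. arrival ?G i) + \<gamma> \<le>
        real N * (class_rate \<xi> lam w h + (\<Sum>m\<in>{1..M}. min_service f w v h m * \<epsilon> h m)) -
        (1 + real K) * (\<Sum>m\<in>{1..M}. min_service f w v h m)"
      using cap by (simp add: C_def class_arrival_def)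
    also have "\<dots> \<le> real N * (class_rate \<xi> lam w h + (\<Sum>m\<in>{1..M}. min_service f w v h m * \<epsilon> h m)) -
        (1 + real (card Q)) * (\<Sum>m\<in>{1..M}. min_service f w v h m)"
      using S0 Q by (intro diff_left_mono mult_right_mono) auto
    also have "\<dots> \<le> (\<Sum>j\<in>class_pool M V h - Q. \<mu> j)"
      unfolding \<mu>_def by (intro class_pool_capacity[OF V h w v f pos sum_p \<open>finite Q\<close>])
    finally show "(\<Sum>i\<in>C. arrival ?G i) + \<gamma> \<le> (\<Sum>j\<in>class_pool M V h - Q. \<mu> j)" .
  qed (use \<gamma> in simp_all)
  then show ?thesis by (simp add: C_def class_arrival_def)
qed

text \<open>Per unit of \<open>N\<close>, \<open>\<Gamma>\<close> is the surplus capacity. It is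
  split into quarters for the fluctuation of the arrival rate, the rounding, up to \<open>K\<close>
  idle servers, and the remaining margin \<open>\<gamma>\<close>. With \<open>K\<close> of order
  \<open>N\<close>, the previous bound becomes small, with thresholds independent of
  \<open>V\<close> and \<open>\<pi>\<close>.\<close>

lemma eventually_prob_class_busy_less:
  assumes f: "f_sequence W \<phi>1 \<phi>2 f" and a: "assumption_a lam"
    and c: "assumption_c W \<phi>1 \<phi>2" and d: "assumption_d W \<xi>"
    and sub: "subcritical H M w v p \<xi> lam f" and \<epsilon>: "\<epsilon> \<in> Poly H M w v p \<xi> lam f"
    and h: "h \<in> {1..H}" and rate: "0 < class_rate \<xi> lam w h" and \<delta>: "0 < \<delta>"
  shows "\<forall>\<^sub>F N in sequentially. \<forall>V \<pi>.
    ICRD_division H M w v p \<xi> lam f \<epsilon> \<phi>2 N V \<and>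
    steady_state (ICRD_system W \<phi>1 \<phi>2 lam f N (ICRD_pool H M w \<phi>1 V)) (ICRD_pool H M w \<phi>1 V)
      (JIQ (ICRD_pool H M w \<phi>1 V)) \<pi> \<longrightarrow>
    measure_pmf.prob \<pi> {s. \<forall>j\<in>class_pool M V h. s j \<noteq> []} < \<delta>"
proof -
  have w: "unit_partition H w" and v: "unit_partition M v"
    and p0: "\<And>m. m \<in> {1..M} \<Longrightarrow> 0 \<le> p h m" and sum_p: "(\<Sum>m\<in>{1..M}. p h m) = 1"
    using sub h by (auto simp: subcritical_def)
  let ?\<mu> = "min_service f w v h" and ?\<Lambda> = "\<lambda>N. class_arrival W \<phi>1 lam w N h"
  define r where "r = class_rate \<xi> lam w h"
  define \<Gamma> where "\<Gamma> = (\<Sum>m\<in>{1..M}. ?\<mu> m * \<epsilon> h m)"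
  define S where "S = (\<Sum>m\<in>{1..M}. ?\<mu> m)"
  have pos: "0 < ?\<mu> m" if "m \<in> {1..M}" "0 < p h m" for m
    by (rule min_service_pos[OF f a d sub h that rate])
  have \<mu>0: "0 \<le> ?\<mu> m" if "m \<in> {1..M}" for m
    by (rule min_service_nonneg[OF f w v h that])
  obtain b where b: "0 < b" "\<forall>m\<in>{1..M}. \<epsilon> h m = b * p h m"
    using \<epsilon> h unfolding Poly_def by blast
  have "\<exists>m\<in>{1..M}. p h m \<noteq> 0"
    using sum_p by (metis sum.neutral zero_neq_one)
  then obtain m where m: "m \<in> {1..M}" "0 < p h m"
    using p0 by force
  \<comment> \<open>The positive factor \<open>b\<close> makes \<open>\<epsilon> h m\<close>
    positive where \<open>p h m\<close> is, and subcriticality makes the minimal rate positive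
    there.\<close>
  have \<Gamma>0: "0 < \<Gamma>"
    unfolding \<Gamma>_def using m pos[OF m] b \<mu>0 p0
    by (intro sum_pos2[of _ m]) auto
  have S0: "0 \<le> S" unfolding S_def by (intro sum_nonneg \<mu>0)
  \<comment> \<open>\<open>\<kappa>\<close> is a proportion of idle servers that costs at most
    \<open>\<Gamma> / 4\<close>; the added 1 keeps the denominator positive.\<close>
  define \<kappa> where "\<kappa> = \<Gamma> / (4 * (S + 1))"
  have \<kappa>: "0 < \<kappa>" "\<kappa> * S \<le> \<Gamma> / 4"
    using \<Gamma>0 S0 by (auto simp: \<kappa>_def field_simps)
  have "(\<lambda>N. ?\<Lambda> N / real N) \<longlonglongrightarrow> r"
    unfolding r_def by (rule class_arrival_tendsto[OF f a c d w h])
  then have "\<forall>\<^sub>F N in sequentially. ?\<Lambda> N / real N < r + \<Gamma> / 4"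
    using \<Gamma>0 by (intro order_tendstoD) auto
  moreover have large: "\<forall>\<^sub>F N in sequentially. b < real N" for b :: real
    using filterlim_real_sequentially by (simp add: filterlim_at_top_dense)
  \<comment> \<open>The thresholds serve, in turn, division by \<open>N\<close>, the rounding loss
    \<open>S \<le> real N * \<Gamma> / 4\<close>, and the size of \<open>K\<close> needed for the
    bound \<open>\<delta>\<close>, where the added 1 absorbs the floor in \<open>K\<close>.\<close>
  note large[of 0] large[of "4 * S / \<Gamma>"] large[of "(4 * (r + \<Gamma>) / (\<delta> * \<Gamma>) + 1) / \<kappa>"]
  ultimately show ?thesis
  proof eventually_elim
    case (elim N)
    define K where "K = nat \<lfloor>\<kappa> * real N\<rfloor>"
    have "0 \<le> \<kappa> * real N" using \<kappa> by simp
    then have K: "real K \<le> \<kappa> * real N" "\<kappa> * real N - 1 < real K"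
      unfolding K_def by linarith+
    have \<Lambda>: "?\<Lambda> N \<le> real N * (r + \<Gamma> / 4)"
      using elim by (simp add: field_simps)
    have S: "S \<le> real N * \<Gamma> / 4"
      using elim \<Gamma>0 by (simp add: field_simps)
    have "real K * S \<le> \<kappa> * real N * S"
      using K S0 by (intro mult_right_mono)
    also have "\<dots> \<le> real N * \<Gamma> / 4"
      using mult_left_mono[OF \<kappa>(2), of "real N"] by (simp add: mult_ac)
    finally have KS: "real K * S \<le> real N * \<Gamma> / 4" .
    have K_large: "4 * (r + \<Gamma>) < \<delta> * \<Gamma> * real K"
    proof -
      have "4 * (r + \<Gamma>) / (\<delta> * \<Gamma>) + 1 < \<kappa> * real N"
        using elim \<kappa> by (simp add: field_simps)
      then have "4 * (r + \<Gamma>) / (\<delta> * \<Gamma>) < real K" using K by linarith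
      then show ?thesis using \<delta> \<Gamma>0 by (simp add: field_simps)
    qed
    show ?case
    proof (intro allI impI, elim conjE)
      fix V \<pi>
      assume V: "ICRD_division H M w v p \<xi> lam f \<epsilon> \<phi>2 N V"
        and stat: "steady_state (ICRD_system W \<phi>1 \<phi>2 lam f N (ICRD_pool H M w \<phi>1 V))
          (ICRD_pool H M w \<phi>1 V) (JIQ (ICRD_pool H M w \<phi>1 V)) \<pi>"
      let ?p = "measure_pmf.prob \<pi> {s. \<forall>j\<in>class_pool M V h. s j \<noteq> []}"
      have "real N * \<Gamma> / 4 * real K * ?p \<le> ?\<Lambda> N"
      proof (rule prob_class_busy_le[OF f a w v V stat refl h _ sum_p])
        show "p h m = 0" if "m \<in> {1..M}" "?\<mu> m = 0" for m
          using pos[OF that(1)] p0[OF that(1)] that(2) by force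
        have "?\<Lambda> N + real N * \<Gamma> / 4 \<le> real N * (r + \<Gamma>) - (1 + real K) * S"
          using \<Lambda> S KS by (simp add: algebra_simps)
        then show "?\<Lambda> N + real N * \<Gamma> / 4 \<le> real N * (class_rate \<xi> lam w h + (\<Sum>m\<in>{1..M}. ?\<mu> m * \<epsilon> h m)) -
            (1 + real K) * (\<Sum>m\<in>{1..M}. ?\<mu> m)"
          by (simp only: r_def \<Gamma>_def S_def)
      qed (use \<Gamma>0 in simp)
      also have "\<dots> \<le> real N * (r + \<Gamma>)"
        using \<Lambda> \<Gamma>0 by (intro order_trans[OF \<Lambda>] mult_left_mono) auto
      finally have "real N * (\<Gamma> * real K * ?p) \<le> real N * (4 * (r + \<Gamma>))"
        by (simp add: field_simps)
      then have "\<Gamma> * real K * ?p \<le> 4 * (r + \<Gamma>)"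
        using elim by (simp only: mult_le_cancel_left_pos)
      then have "\<Gamma> * real K * ?p < \<Gamma> * real K * \<delta>"
        using K_large by (simp add: mult_ac)
      then show "?p < \<delta>"
        using \<Gamma>0 by (simp add: mult_less_cancel_left)
    qed
  qed
qed

text \<open>If some server of the pool is idle, JIQ gives probability 0 to all busy servers;
  otherwise the trivial bound 1 applies. Weighting by type leaves the share of each class in the
  total arrival rate.\<close>

lemma prob_join_busy_le:
  assumes f: "f_sequence W \<phi>1 \<phi>2 f" and a: "assumption_a lam"
    and w: "unit_partition H w" and V: "ICRD_division H M w v p \<xi> lam f \<epsilon> \<phi>2 N V"
    and pool: "pool = ICRD_pool H M w \<phi>1 V"
  shows "prob_join_busy (ICRD_system W \<phi>1 \<phi>2 lam f N pool) (JIQ pool) \<pi> \<le>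
    (\<Sum>h\<in>{1..H}. class_arrival W \<phi>1 lam w N h / (\<Sum>i\<in>{1..W N}. lam (\<phi>1 i)) *
      measure_pmf.prob \<pi> {s. \<forall>j\<in>class_pool M V h. s j \<noteq> []})"
proof -
  define \<Lambda> where "\<Lambda> = (\<Sum>i\<in>{1..W N}. lam (\<phi>1 i))"
  let ?B = "\<lambda>h. {s. \<forall>j\<in>class_pool M V h. s j \<noteq> []}"
  have \<phi>1: "\<phi>1 i \<in> {0..<1}" for i using f by (auto simp: f_sequence_def)
  have lam0: "0 \<le> lam (\<phi>1 i)" for i using a \<phi>1 by (simp add: assumption_a_def)
  have \<Lambda>0: "0 \<le> \<Lambda>" unfolding \<Lambda>_def by (intro sum_nonneg lam0)
  have cover: "{1..W N} = (\<Union>h\<in>{1..H}. dispatcher_class W \<phi>1 w N h)"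
    using unit_partition_cover[OF w \<phi>1] by (auto simp: dispatcher_class_def)
  have sum_classes: "(\<Sum>i\<in>{1..W N}. u i) = (\<Sum>h\<in>{1..H}. \<Sum>i\<in>dispatcher_class W \<phi>1 w N h. u i)"
    for u :: "nat \<Rightarrow> real"
    unfolding cover using unit_partition_cell_unique[OF w]
    by (intro sum.UNION_disjoint) (auto simp: dispatcher_class_def)
  have assigned: "(\<Sum>j\<in>{j \<in> {1..N}. s j \<noteq> []}. JIQ pool s i j) \<le> indicat_real (?B h) s"
    if h: "h \<in> {1..H}" and i: "i \<in> dispatcher_class W \<phi>1 w N h" for s i h
  proof (cases "s \<in> ?B h")
    case True
    then show ?thesis by (simp add: sum_JIQ_le_1)
  next
    case False
    have "pool i = class_pool M V h"
      unfolding pool using i by (intro ICRD_pool_eq[OF w h]) (simp add: dispatcher_class_def)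
    then obtain k where "k \<in> pool i" "s k = []" using False by auto
    then have "(\<Sum>j\<in>{j \<in> {1..N}. s j \<noteq> []}. JIQ pool s i j) = 0"
      by (intro sum.neutral) (auto intro: JIQ_busy_eq_0)
    then show ?thesis by simp
  qed
  have bound: "(\<Sum>i\<in>{1..W N}. lam (\<phi>1 i) / \<Lambda> * (\<Sum>j\<in>{j \<in> {1..N}. s j \<noteq> []}. JIQ pool s i j)) \<le>
      (\<Sum>h\<in>{1..H}. class_arrival W \<phi>1 lam w N h / \<Lambda> * indicat_real (?B h) s)" for s
  proof -
    have "(\<Sum>i\<in>{1..W N}. lam (\<phi>1 i) / \<Lambda> * (\<Sum>j\<in>{j \<in> {1..N}. s j \<noteq> []}. JIQ pool s i j)) \<le>
        (\<Sum>h\<in>{1..H}. \<Sum>i\<in>dispatcher_class W \<phi>1 w N h. lam (\<phi>1 i) / \<Lambda> * indicat_real (?B h) s)"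
      unfolding sum_classes
      by (intro sum_mono mult_left_mono assigned divide_nonneg_nonneg lam0 \<Lambda>0)
    then show ?thesis
      by (simp add: class_arrival_def sum_divide_distrib sum_distrib_right)
  qed
  have int: "integrable (measure_pmf \<pi>) (indicat_real A)" for A
    by (rule measure_pmf.integrable_const_bound[where B = 1]) auto
  have "prob_join_busy (ICRD_system W \<phi>1 \<phi>2 lam f N pool) (JIQ pool) \<pi> =
      measure_pmf.expectation \<pi> (\<lambda>s. \<Sum>i\<in>{1..W N}. lam (\<phi>1 i) / \<Lambda> *
        (\<Sum>j\<in>{j \<in> {1..N}. s j \<noteq> []}. JIQ pool s i j))"
    by (simp add: prob_join_busy_def \<Lambda>_def)
  also have "\<dots> \<le> measure_pmf.expectation \<pi> (\<lambda>s. \<Sum>h\<in>{1..H}. class_arrival W \<phi>1 lam w N h / \<Lambda> * indicat_real (?B h) s)"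
    using int lam0 \<Lambda>0
    by (intro integral_mono' bound) (auto simp: class_arrival_def intro!: sum_nonneg mult_nonneg_nonneg divide_nonneg_nonneg)
  also have "\<dots> = (\<Sum>h\<in>{1..H}. class_arrival W \<phi>1 lam w N h / \<Lambda> * measure_pmf.prob \<pi> (?B h))"
    using int by (subst Bochner_Integration.integral_sum) auto
  finally show ?thesis by (simp add: \<Lambda>_def)
qed

text \<open>Neither the division nor the stationary distribution is a given function of
  \<open>N\<close>, so convergence is expressed by thresholds uniform in \<open>V\<close> and
  \<open>\<pi>\<close>.\<close>

theorem theorem3p14:
  fixes W :: "nat \<Rightarrow> nat" and \<phi>1 \<phi>2 :: "nat \<Rightarrow> real"
    and f :: "real \<Rightarrow> real \<Rightarrow> real" and lam :: "real \<Rightarrow> real" and \<xi> :: real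
    and H M :: nat and w v :: "nat \<Rightarrow> real" and p \<epsilon> :: "nat \<Rightarrow> nat \<Rightarrow> real"
  assumes "f_sequence W \<phi>1 \<phi>2 f"
    and "assumption_a lam"
    and "assumption_b f"
    and "assumption_c W \<phi>1 \<phi>2"
    and "assumption_d W \<xi>"
    and "subcritical H M w v p \<xi> lam f"
    and "\<epsilon> \<in> Poly H M w v p \<xi> lam f"
  shows "\<forall>\<delta>>0. \<forall>\<^sub>F N in sequentially. \<forall>V \<pi>.
    (let pool = ICRD_pool H M w \<phi>1 V;
         G = restrict_system (f_system W \<phi>1 \<phi>2 lam f N) pool
     in ICRD_division H M w v p \<xi> lam f \<epsilon> \<phi>2 N V \<and> steady_state G pool (JIQ pool) \<pi>
          \<longrightarrow> prob_join_busy G (JIQ pool) \<pi> < \<delta>)"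
proof (intro allI impI)
  fix \<delta> :: real assume \<delta>: "0 < \<delta>"
  note f = assms(1) and a = assms(2) and c = assms(4) and d = assms(5) and sub = assms(6) and \<epsilon> = assms(7)
  have w: "unit_partition H w" using sub by (simp add: subcritical_def)
  have "0 < H" using w by (intro gr0I) (auto simp: unit_partition_def)
  \<comment> \<open>\<open>\<delta>\<close> is shared equally among the \<open>H\<close>
    classes.\<close>
  define \<eta> where "\<eta> = \<delta> / real H"
  have \<eta>: "0 < \<eta>" using \<delta> \<open>0 < H\<close> by (simp add: \<eta>_def)
  let ?\<Lambda> = "\<lambda>N. class_arrival W \<phi>1 lam w N" and ?T = "\<lambda>N. \<Sum>i\<in>{1..W N}. lam (\<phi>1 i)"
  let ?B = "\<lambda>V h. {s. \<forall>j\<in>class_pool M V h. s j \<noteq> []}"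
  let ?hyp = "\<lambda>N V \<pi>. ICRD_division H M w v p \<xi> lam f \<epsilon> \<phi>2 N V \<and>
    steady_state (ICRD_system W \<phi>1 \<phi>2 lam f N (ICRD_pool H M w \<phi>1 V)) (ICRD_pool H M w \<phi>1 V)
      (JIQ (ICRD_pool H M w \<phi>1 V)) \<pi>"
  have lam0: "0 \<le> lam (\<phi>1 i)" for i
    using a f by (simp add: assumption_a_def f_sequence_def)
  have share: "0 \<le> ?\<Lambda> N h / ?T N" "?\<Lambda> N h / ?T N \<le> 1" for N h
  proof -
    have "0 \<le> ?\<Lambda> N h" unfolding class_arrival_def by (intro sum_nonneg lam0)
    moreover have "?\<Lambda> N h \<le> ?T N"
      unfolding class_arrival_def by (intro sum_mono2) (auto simp: lam0 dispatcher_class_def)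
    ultimately show "0 \<le> ?\<Lambda> N h / ?T N" "?\<Lambda> N h / ?T N \<le> 1"
      by (auto simp: divide_le_eq_1 zero_le_divide_iff)
  qed
  have "\<forall>\<^sub>F N in sequentially. \<forall>V \<pi>. ?hyp N V \<pi> \<longrightarrow>
      ?\<Lambda> N h / ?T N * measure_pmf.prob \<pi> (?B V h) < \<eta>" if h: "h \<in> {1..H}" for h
  proof (cases "class_rate \<xi> lam w h = 0")
    case True
    \<comment> \<open>Here the pool may have no surplus capacity, as its minimal rates can vanish.
      Instead the share of the class tends to 0, the limiting total rate being positive by (a) and
      (d), and the probability is at most 1.\<close>
    have "(\<lambda>N. (?\<Lambda> N h / real N) / (?T N / real N)) \<longlonglongrightarrow> 0 / (\<xi> * integral {0..<1} lam)"
      using class_arrival_tendsto[OF f a c d w h] total_arrival_tendsto[OF f a c d] True a d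
      by (intro tendsto_divide) (auto simp: assumption_a_def assumption_d_def)
    then have "(\<lambda>N. (?\<Lambda> N h / real N) / (?T N / real N)) \<longlonglongrightarrow> 0"
      by simp
    then have "\<forall>\<^sub>F N in sequentially. (?\<Lambda> N h / real N) / (?T N / real N) < \<eta>"
      using \<eta> by (rule order_tendstoD)
    then show ?thesis
      using eventually_gt_at_top[of 0]
    proof eventually_elim
      case (elim N)
      then have "?\<Lambda> N h / ?T N < \<eta>" by simp
      then show ?case
        using le_less_trans[OF mult_left_le[OF measure_pmf.prob_le_1 share(1)[of N h]]] by blast
    qed
  next
    case False
    then have "0 < class_rate \<xi> lam w h"
      using class_rate_nonneg[OF a d w h] by simp
    from eventually_prob_class_busy_less[OF f a c d sub \<epsilon> h this \<eta>] show ?thesis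
    proof (rule eventually_mono)
      fix N
      assume *: "\<forall>V \<pi>. ?hyp N V \<pi> \<longrightarrow> measure_pmf.prob \<pi> (?B V h) < \<eta>"
      show "\<forall>V \<pi>. ?hyp N V \<pi> \<longrightarrow> ?\<Lambda> N h / ?T N * measure_pmf.prob \<pi> (?B V h) < \<eta>"
      proof (intro allI impI)
        fix V \<pi> assume "?hyp N V \<pi>"
        with * have "measure_pmf.prob \<pi> (?B V h) < \<eta>" by blast
        with mult_left_le_one_le[OF measure_nonneg share(1,2)]
        show "?\<Lambda> N h / ?T N * measure_pmf.prob \<pi> (?B V h) < \<eta>"
          by (rule le_less_trans)
      qed
    qed
  qed
  then have "\<forall>\<^sub>F N in sequentially. \<forall>h\<in>{1..H}. \<forall>V \<pi>. ?hyp N V \<pi> \<longrightarrow>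
      ?\<Lambda> N h / ?T N * measure_pmf.prob \<pi> (?B V h) < \<eta>"
    by (intro eventually_ball_finite) auto
  then show "\<forall>\<^sub>F N in sequentially. \<forall>V \<pi>.
    (let pool = ICRD_pool H M w \<phi>1 V;
         G = restrict_system (f_system W \<phi>1 \<phi>2 lam f N) pool
     in ICRD_division H M w v p \<xi> lam f \<epsilon> \<phi>2 N V \<and> steady_state G pool (JIQ pool) \<pi>
          \<longrightarrow> prob_join_busy G (JIQ pool) \<pi> < \<delta>)"
  proof (rule eventually_mono)
    fix N
    assume *: "\<forall>h\<in>{1..H}. \<forall>V \<pi>. ?hyp N V \<pi> \<longrightarrow> ?\<Lambda> N h / ?T N * measure_pmf.prob \<pi> (?B V h) < \<eta>"
    have "prob_join_busy (ICRD_system W \<phi>1 \<phi>2 lam f N (ICRD_pool H M w \<phi>1 V)) (JIQ (ICRD_pool H M w \<phi>1 V)) \<pi> < \<delta>"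
      if hyp: "?hyp N V \<pi>" for V \<pi>
    proof -
      have "prob_join_busy (ICRD_system W \<phi>1 \<phi>2 lam f N (ICRD_pool H M w \<phi>1 V)) (JIQ (ICRD_pool H M w \<phi>1 V)) \<pi> \<le>
          (\<Sum>h\<in>{1..H}. ?\<Lambda> N h / ?T N * measure_pmf.prob \<pi> (?B V h))"
        using hyp by (intro prob_join_busy_le[OF f a w _ refl]) blast
      also have "\<dots> < (\<Sum>h\<in>{1..H}. \<eta>)"
        using * hyp \<open>0 < H\<close> by (intro sum_strict_mono) auto
      also have "\<dots> = \<delta>"
        using \<open>0 < H\<close> by (simp add: \<eta>_def)
      finally show ?thesis .
    qed
    then show "\<forall>V \<pi>. (let pool = ICRD_pool H M w \<phi>1 V;
         G = restrict_system (f_system W \<phi>1 \<phi>2 lam f N) pool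
     in ICRD_division H M w v p \<xi> lam f \<epsilon> \<phi>2 N V \<and> steady_state G pool (JIQ pool) \<pi>
          \<longrightarrow> prob_join_busy G (JIQ pool) \<pi> < \<delta>)"
      by (simp add: Let_def)
  qed
qed

end
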